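(* Let $\mathbb{G}$ be a stratified Lie group with first stratum of dimension $N$ and first-stratum variables $x'$. Let $1<p,q<\infty$, $0<r<\infty$ with $p+q\ge r$, $\delta\in[0,1]\cap\left[\frac{r-q}{r},\frac{p}{r}\right]$, and $\alpha,b,c\in\mathbb{R}$ with $\frac{\delta r}{p}+\frac{(1-\delta)r}{q}=1$ and $c=-\delta+b(1-\delta)$. Then for every complex-valued $f\in C_0^\infty(\mathbb{G}\setminus\{x'=0\})$, $$\left|\frac{N-\alpha}{p}\right|^\delta\left\||x'|^{\alpha c/p}f\right\|_{L^r(\mathbb{G})}\le\left[\left\|\frac{x'\cdot\nabla_Hf}{|x'|^{\alpha/p}}\right\|_{L^p(\mathbb{G})}^p-\int_{\mathbb{G}}C_p\!\left(\frac{x'\cdot\nabla_Hf}{|x'|^{\alpha/p}},\frac{x'\cdot\nabla_Hf}{|x'|^{\alpha/p}}+\frac{N-\alpha}{p}\frac{f}{|x'|^{\alpha/p}}\right)dx\right]^{\delta/p}\left\||x'|^{\alpha b/p}f\right\|_{L^q(\mathbb{G})}^{1-\delta}.$$ Moreover, when $\alpha\ne N$, the constant $\left|\frac{N-\alpha}{p}\right|^\delta$ is sharp in the case $q=p$ with $b=-1$, and in the cases $\delta\in\{0,1\}$.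
   Context: A stratified Lie group is $\mathbb{G}=(\mathbb{R}^n,\cdot)$ with a decomposition $\mathbb{R}^n=\mathbb{R}^{N}\times\mathbb{R}^{N_2}\times\cdots\times\mathbb{R}^{N_r}$ such that each dilation $\delta_\lambda(x',x^{(2)},\dots,x^{(r)})=(\lambda x',\lambda^2x^{(2)},\dots,\lambda^rx^{(r)})$ is a group automorphism, and the left-invariant vector fields $X_1,\dots,X_N$ with $X_j(0)=\partial_{x_j}|_0$ Lie-generate the tangent space everywhere. $x'=(x_1,\dots,x_N)$, $|x'|$ is its Euclidean norm, $\nabla_H=(X_1,\dots,X_N)$, $x'\cdot\nabla_Hf=\sum_{j=1}^Nx_jX_jf$; integration is against Lebesgue (Haar) measure. For complex $\xi,\eta$, $C_p(\xi,\eta):=|\xi|^p-|\xi-\eta|^p-p|\xi-\eta|^{p-2}\operatorname{Re}((\xi-\eta)\overline{\eta})$ (last term $0$ when $\xi=\eta$). Sharp means the constant cannot be replaced by a larger one. *)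

theory Defs
  imports "HOL-Analysis.Analysis"
begin

fun Ck_on :: "nat \<Rightarrow> 'a set \<Rightarrow> ('a::real_normed_vector \<Rightarrow> 'b::real_normed_vector) \<Rightarrow> bool" where
  "Ck_on 0 S f = continuous_on S f"
| "Ck_on (Suc k) S f =
     ((\<forall>x\<in>S. f differentiable (at x)) \<and>
      (\<forall>v. Ck_on k S (\<lambda>x. frechet_derivative f (at x) v)))"

definition smooth_on :: "'a set \<Rightarrow> ('a::real_normed_vector \<Rightarrow> 'b::real_normed_vector) \<Rightarrow> bool" where
  "smooth_on S f = (\<forall>k. Ck_on k S f)"

text \<open>Points are vectors in real^'n.  The stratification is encoded by a degree function
deg :: 'n => nat: coordinate j belongs to the stratum R^{N_deg j}.  The first stratum
consists of the coordinates of degree 1.\<close>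

definition dil :: "('n::finite \<Rightarrow> nat) \<Rightarrow> real \<Rightarrow> real^'n \<Rightarrow> real^'n" where
  "dil deg t x = (\<chi> j. t ^ deg j * x $ j)"

definition first_stratum :: "('n::finite \<Rightarrow> nat) \<Rightarrow> 'n set" where
  "first_stratum deg = {j. deg j = 1}"

definition Ndim :: "('n::finite \<Rightarrow> nat) \<Rightarrow> nat" where
  "Ndim deg = card (first_stratum deg)"

definition xnorm :: "('n::finite \<Rightarrow> nat) \<Rightarrow> real^'n \<Rightarrow> real" where
  "xnorm deg x = sqrt (\<Sum>j\<in>first_stratum deg. (x $ j)^2)"

text \<open>Left-invariant vector field X_j with X_j(0) = d/dx_j at 0 (0 is the identity):
X_j(x) = d(L_x)(0) e_j, where L_x y = x . y.\<close>
definition Xfield :: "(real^'n \<Rightarrow> real^'n \<Rightarrow> real^'n) \<Rightarrow> 'n::finite \<Rightarrow> real^'n \<Rightarrow> real^'n" where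
  "Xfield gmul j x = frechet_derivative (gmul x) (at 0) (axis j 1)"

definition Xop :: "(real^'n \<Rightarrow> real^'n \<Rightarrow> real^'n) \<Rightarrow> 'n::finite \<Rightarrow>
    (real^'n \<Rightarrow> 'b::real_normed_vector) \<Rightarrow> real^'n \<Rightarrow> 'b" where
  "Xop gmul j f x = frechet_derivative f (at x) (Xfield gmul j x)"

definition lie_bracket :: "(real^'n \<Rightarrow> real^'n) \<Rightarrow> (real^'n \<Rightarrow> real^'n) \<Rightarrow> real^'n \<Rightarrow> real^'n" where
  "lie_bracket V W x = frechet_derivative W (at x) (V x) - frechet_derivative V (at x) (W x)"

inductive_set gen_fields :: "(real^'n \<Rightarrow> real^'n \<Rightarrow> real^'n) \<Rightarrow> ('n::finite \<Rightarrow> nat)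
    \<Rightarrow> (real^'n \<Rightarrow> real^'n) set"
  for gmul deg where
  base: "j \<in> first_stratum deg \<Longrightarrow> Xfield gmul j \<in> gen_fields gmul deg"
| brk: "V \<in> gen_fields gmul deg \<Longrightarrow> W \<in> gen_fields gmul deg \<Longrightarrow>
        lie_bracket V W \<in> gen_fields gmul deg"

definition stratified_group :: "(real^'n \<Rightarrow> real^'n \<Rightarrow> real^'n) \<Rightarrow> ('n::finite \<Rightarrow> nat) \<Rightarrow> bool" where
  "stratified_group gmul deg \<longleftrightarrow>
     \<comment> \<open>(R^n, gmul) is a Lie group with identity 0\<close>
     (\<forall>x y z. gmul (gmul x y) z = gmul x (gmul y z)) \<and>
     (\<forall>x. gmul 0 x = x \<and> gmul x 0 = x) \<and>
     (\<forall>x. \<exists>y. gmul x y = 0 \<and> gmul y x = 0) \<and>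
     smooth_on UNIV (\<lambda>(x, y). gmul x y) \<and>
     \<comment> \<open>graded coordinates R^N x R^N2 x ... x R^Nr\<close>
     (\<forall>j. 1 \<le> deg j) \<and>
     \<comment> \<open>dilations are group automorphisms\<close>
     (\<forall>t>0. \<forall>x y. dil deg t (gmul x y) = gmul (dil deg t x) (dil deg t y)) \<and>
     \<comment> \<open>X_1,...,X_N Lie-generate the tangent space at every point\<close>
     (\<forall>x. span {V x | V. V \<in> gen_fields gmul deg} = UNIV)"

text \<open>Real power with the convention t^0 = 1 (also for t = 0).\<close>
definition rpow :: "real \<Rightarrow> real \<Rightarrow> real" where
  "rpow t a = (if a = 0 then 1 else t powr a)"

text \<open>L^p norm w.r.t. Lebesgue (Haar) measure.\<close>
definition Lp_norm :: "real \<Rightarrow> (real^'n::finite \<Rightarrow> 'b::real_normed_vector) \<Rightarrow> real" where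
  "Lp_norm p g = (\<integral>x. norm (g x) powr p \<partial>lborel) powr (1 / p)"

definition radial_H :: "(real^'n \<Rightarrow> real^'n \<Rightarrow> real^'n) \<Rightarrow> ('n::finite \<Rightarrow> nat) \<Rightarrow>
    (real^'n \<Rightarrow> complex) \<Rightarrow> real^'n \<Rightarrow> complex" where
  "radial_H gmul deg f x = (\<Sum>j\<in>first_stratum deg. complex_of_real (x $ j) * Xop gmul j f x)"

definition Cp :: "real \<Rightarrow> complex \<Rightarrow> complex \<Rightarrow> real" where
  "Cp p \<xi> \<eta> = cmod \<xi> powr p - cmod (\<xi> - \<eta>) powr p
     - (if \<xi> = \<eta> then 0 else p * cmod (\<xi> - \<eta>) powr (p - 2) * Re ((\<xi> - \<eta>) * cnj \<eta>))"

definition test_funs :: "('n::finite \<Rightarrow> nat) \<Rightarrow> (real^'n \<Rightarrow> complex) set" where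
  "test_funs deg = {f. smooth_on {x. xnorm deg x \<noteq> 0} f \<and>
      (\<exists>K. compact K \<and> K \<subseteq> {x. xnorm deg x \<noteq> 0} \<and> (\<forall>x. x \<notin> K \<longrightarrow> f x = 0))}"

definition gl_lhs_norm :: "('n::finite \<Rightarrow> nat) \<Rightarrow> real \<Rightarrow> real \<Rightarrow> real \<Rightarrow> real \<Rightarrow>
    (real^'n \<Rightarrow> complex) \<Rightarrow> real" where
  "gl_lhs_norm deg p r \<alpha> c f =
     Lp_norm r (\<lambda>x. complex_of_real (xnorm deg x powr (\<alpha> * c / p)) * f x)"

definition gl_rhs :: "(real^'n \<Rightarrow> real^'n \<Rightarrow> real^'n) \<Rightarrow> ('n::finite \<Rightarrow> nat) \<Rightarrow>
    real \<Rightarrow> real \<Rightarrow> real \<Rightarrow> real \<Rightarrow> real \<Rightarrow> (real^'n \<Rightarrow> complex) \<Rightarrow> real" where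
  "gl_rhs gmul deg p q \<alpha> b \<delta> f =
     (let \<xi> = (\<lambda>x. radial_H gmul deg f x / complex_of_real (xnorm deg x powr (\<alpha> / p)));
          \<eta> = (\<lambda>x. \<xi> x + complex_of_real ((real (Ndim deg) - \<alpha>) / p)
                        * (f x / complex_of_real (xnorm deg x powr (\<alpha> / p))))
      in rpow (Lp_norm p \<xi> powr p - (\<integral>x. Cp p (\<xi> x) (\<eta> x) \<partial>lborel)) (\<delta> / p)
         * rpow (Lp_norm q (\<lambda>x. complex_of_real (xnorm deg x powr (\<alpha> * b / p)) * f x)) (1 - \<delta>))"

end

theory Submission
  imports Defs
begin

text \<open>
  Let \<open>R = \<Sum> x\<^sub>j X\<^sub>j\<close> (sum over the first stratum) and \<open>k = (N - \<alpha>) / p\<close>. Homogeneity under dilations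
  forces the \<open>i\<close>-th component of \<open>X\<^sub>j\<close> to be independent of all variables of degree at least \<open>deg i\<close>.
  Hence each \<open>X\<^sub>j\<close> is divergence free and \<open>X\<^sub>j x\<^sub>i\<close> is the Kronecker delta on the first stratum, so
  \<open>div R = N\<close> and \<open>R |x'|\<^sup>a = a |x'|\<^sup>a\<close>. Integrating \<open>div (|x'|\<^sup>-\<^sup>\<alpha> |f|\<^sup>p R)\<close> and expanding \<open>C\<^sub>p\<close> shows that
  the bracket equals \<open>|k|\<^sup>p \<integral> |x'|\<^sup>-\<^sup>\<alpha> |f|\<^sup>p\<close> exactly. The inequality is then Hoelder's inequality, and in
  the cases where sharpness is claimed Hoelder's inequality is trivially an equality, so any nonzero
  test function shows that the constant is optimal.
\<close>

section \<open>Integrals of compactly supported functions\<close>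

lemma integrable_compact_support:
  fixes f :: "'a::euclidean_space \<Rightarrow> 'b::{banach, second_countable_topology}"
  assumes "compact K" "continuous_on K f" "\<And>x. x \<notin> K \<Longrightarrow> f x = 0"
  shows "integrable lborel f"
proof -
  have "f = (\<lambda>x. indicator K x *\<^sub>R f x)"
    using assms(3) by (auto simp: indicator_def)
  with borel_integrable_compact[OF assms(1,2)] show ?thesis by simp
qed

lemma integral_lborel_translation:
  fixes f :: "'a::euclidean_space \<Rightarrow> 'b::{banach, second_countable_topology}"
  assumes "f \<in> borel_measurable borel"
  shows "(\<integral>x. f (a + x) \<partial>lborel) = (\<integral>x. f x \<partial>lborel)"
proof -
  have "(\<integral>x. f x \<partial>lborel) = (\<integral>x. f x \<partial>distr lborel borel ((+) a))"
    by (simp add: lborel_distr_plus)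
  also have "\<dots> = (\<integral>x. f (a + x) \<partial>lborel)"
    using assms by (subst integral_distr) auto
  finally show ?thesis ..
qed

text \<open>By translation invariance every difference quotient of \<open>g\<close> along
  \<open>v\<close> has integral 0. Dominated convergence carries this to the derivative, so no
  iterated integrals are involved.\<close>

lemma integral_directional_derivative_eq_0:
  fixes g :: "'a::euclidean_space \<Rightarrow> real"
  assumes der: "\<And>x. (g has_derivative g' x) (at x)"
    and cont: "continuous_on UNIV (\<lambda>x. g' x v)"
    and K: "compact K" "\<And>x. x \<notin> K \<Longrightarrow> g x = 0"
  shows "(\<integral>x. g' x v \<partial>lborel) = 0"
proof -
  \<comment> \<open>Steps in (0,1] tending to 0; the bound 1 keeps all translates of
    \<open>K\<close> inside one fixed ball.\<close>
  define t where "t = (\<lambda>n::nat. inverse (real (Suc n)))"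
  define q where "q = (\<lambda>n x. (g (t n *\<^sub>R v + x) - g x) / t n)"
  have t0: "t n > 0" "t n \<le> 1" for n
    by (auto simp: t_def field_simps)
  have gcont: "continuous_on UNIV g"
    using der has_derivative_continuous_on by blast
  have gmeas[measurable]: "g \<in> borel_measurable borel"
    using gcont by (rule borel_measurable_continuous_onI)
  have gint: "integrable lborel g"
    using K gcont continuous_on_subset by (intro integrable_compact_support[of K]) blast+
  obtain B where B: "\<And>x. x \<in> K \<Longrightarrow> norm x \<le> B"
    using compact_imp_bounded[OF K(1)] by (auto simp: bounded_iff)
  have g'0: "g' x v = 0" if "x \<notin> K" for x
  proof -
    have "(g has_derivative (\<lambda>_. 0)) (at x)"
      by (rule has_derivative_transform_within_open[of "\<lambda>_. 0" _ _ _ "-K"])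
         (use that K compact_imp_closed in auto)
    then show ?thesis
      using has_derivative_unique[OF der] by metis
  qed
  have "bounded ((\<lambda>x. g' x v) ` K)"
    using K(1) cont continuous_on_subset compact_continuous_image compact_imp_bounded by (metis top_greatest)
  then obtain M0 where M0: "\<And>x. x \<in> K \<Longrightarrow> \<bar>g' x v\<bar> \<le> M0"
    by (auto simp: bounded_iff)
  \<comment> \<open>The maximum with 0 makes the bound valid off \<open>K\<close> too, where the
    derivative is 0; \<open>M0\<close> may be negative if \<open>K\<close> is empty.\<close>
  define M where "M = max M0 0"
  have M: "\<bar>g' x v\<bar> \<le> M" for x
    using M0[of x] g'0[of x] by (cases "x \<in> K") (auto simp: M_def)
  \<comment> \<open>The mean value theorem on the segment from x to x + t_n v gives a bound
    independent of n.\<close>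
  have lip: "\<bar>q n x\<bar> \<le> M" for n x
  proof -
    have d: "((\<lambda>s. g (s *\<^sub>R v + x)) has_derivative (\<lambda>h. h * g' (s *\<^sub>R v + x) v)) (at s)" for s
    proof -
      have "((\<lambda>s. g (s *\<^sub>R v + x)) has_derivative (\<lambda>h. g' (s *\<^sub>R v + x) (h *\<^sub>R v))) (at s)"
        by (rule has_derivative_compose[of "\<lambda>s. s *\<^sub>R v + x" "\<lambda>h. h *\<^sub>R v" s UNIV g, OF _ der])
           (auto intro!: derivative_eq_intros)
      moreover have "g' (s *\<^sub>R v + x) (h *\<^sub>R v) = h * g' (s *\<^sub>R v + x) v" for h
        using linear_scale[OF has_derivative_linear[OF der]] by simp
      ultimately show ?thesis by simp
    qed
    obtain z where "g (t n *\<^sub>R v + x) - g (0 *\<^sub>R v + x) = (t n - 0) * g' (z *\<^sub>R v + x) v"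
      using mvt_simple[of 0 "t n" "\<lambda>s. g (s *\<^sub>R v + x)", OF t0(1) has_derivative_at_withinI[OF d]] by blast
    then have "q n x = g' (z *\<^sub>R v + x) v"
      using t0(1)[of n] by (simp add: q_def)
    then show ?thesis using M by simp
  qed
  \<comment> \<open>Outside this ball neither x nor x + t_n v lies in \<open>K\<close>, since |t_n
    v| \<le> |v|, so the quotient is 0 there.\<close>
  let ?w = "\<lambda>x. indicator (cball 0 (B + norm v)) x * M"
  have wint: "integrable lborel ?w"
    using borel_integrable_compact[of "cball 0 (B + norm v)" "\<lambda>_. M"] by simp
  have bound: "norm (q n x) \<le> ?w x" for n x
  proof (cases "norm x \<le> B + norm v")
    case True
    then show ?thesis using lip[of n x] by (simp add: indicator_def)
  next
    case False
    have "x \<notin> K" using False B[of x] norm_ge_zero[of v] by linarith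
    have "norm (t n *\<^sub>R v) \<le> norm v"
      using t0[of n] by (simp add: mult_left_le_one_le)
    then have "norm (t n *\<^sub>R v + x) > B"
      using False norm_triangle_ineq2[of x "- (t n *\<^sub>R v)"] by (simp add: add.commute)
    then have "t n *\<^sub>R v + x \<notin> K" using B by fastforce
    then show ?thesis using \<open>x \<notin> K\<close> False K(2) by (simp add: q_def indicator_def)
  qed
  have lim: "(\<lambda>n. q n x) \<longlonglongrightarrow> g' x v" for x
  proof -
    have "((\<lambda>s. g (s *\<^sub>R v + x)) has_derivative (\<lambda>h. g' x (h *\<^sub>R v))) (at 0)"
      by (rule has_derivative_compose[of "\<lambda>s. s *\<^sub>R v + x" "\<lambda>h. h *\<^sub>R v" 0 UNIV g "g' x", simplified])
         (auto intro!: derivative_eq_intros der)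
    moreover have "g' x (h *\<^sub>R v) = g' x v * h" for h
      using linear_scale[OF has_derivative_linear[OF der]] by simp
    ultimately have "((\<lambda>s. g (s *\<^sub>R v + x)) has_field_derivative g' x v) (at 0)"
      by (simp add: has_field_derivative_def)
    then have "((\<lambda>s. (g (s *\<^sub>R v + x) - g x) / s) \<longlongrightarrow> g' x v) (at 0)"
      by (simp add: has_field_derivative_iff)
    moreover have "filterlim t (at 0) sequentially"
      unfolding t_def filterlim_at using LIMSEQ_inverse_real_of_nat by auto
    ultimately show ?thesis
      unfolding q_def by (rule filterlim_compose)
  qed
  have shift_int: "integrable lborel (\<lambda>x. g (a + x))" for a
  proof -
    have "integrable (distr lborel borel ((+) a)) g"
      using gint by (simp add: lborel_distr_plus)
    then show ?thesis by (subst (asm) integrable_distr_eq) auto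
  qed
  have int0: "(\<integral>x. q n x \<partial>lborel) = 0" for n
    by (simp add: q_def integral_lborel_translation[OF gmeas] gint shift_int)
  have "(\<lambda>n. \<integral>x. q n x \<partial>lborel) \<longlonglongrightarrow> (\<integral>x. g' x v \<partial>lborel)"
  proof (rule integral_dominated_convergence[where w = ?w])
    show "(\<lambda>x. g' x v) \<in> borel_measurable lborel"
      using cont by (simp add: borel_measurable_continuous_onI)
    show "q n \<in> borel_measurable lborel" for n
      unfolding q_def by measurable
  qed (use wint lim bound in auto)
  then show ?thesis
    using int0 LIMSEQ_unique[OF tendsto_const] by force
qed

text \<open>Hoelder's inequality for the exponents 1/s and 1/(1-s), proved by normalising both
  integrals to 1 and applying the weighted arithmetic-geometric mean inequality pointwise. The
  powers sit on the integrands because the interpolation below splits its integrand in exactly this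
  way.\<close>

lemma integral_Holder_interpolation:
  fixes A B :: "'a \<Rightarrow> real"
  assumes A: "integrable M A" "\<And>x. A x \<ge> 0" and B: "integrable M B" "\<And>x. B x \<ge> 0"
    and s: "0 < s" "s < 1"
  shows "(\<integral>x. A x powr s * B x powr (1 - s) \<partial>M) \<le> (\<integral>x. A x \<partial>M) powr s * (\<integral>x. B x \<partial>M) powr (1 - s)"
proof -
  define a where "a = (\<integral>x. A x \<partial>M)"
  define b where "b = (\<integral>x. B x \<partial>M)"
  have mA[measurable]: "A \<in> borel_measurable M" and mB[measurable]: "B \<in> borel_measurable M"
    using A B by auto
  have young: "x powr s * y powr (1 - s) \<le> s * x + (1 - s) * y" if "x \<ge> 0" "y \<ge> 0" for x y :: real
    using Youngs_inequality_0[of s "1 - s" x y] s that by (cases "x = 0 \<or> y = 0") auto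
  have ab: "a \<ge> 0" "b \<ge> 0"
    using A(2) B(2) by (auto simp: a_def b_def)
  consider "a = 0 \<or> b = 0" | "a > 0" "b > 0" using ab by fastforce
  then show ?thesis
  proof cases
    \<comment> \<open>Normalisation would divide by 0 here, but one factor vanishes almost
      everywhere, and with it the product.\<close>
    case 1
    then have "AE x in M. A x = 0 \<or> B x = 0"
      using integral_nonneg_eq_0_iff_AE[OF A(1)] integral_nonneg_eq_0_iff_AE[OF B(1)] A(2) B(2)
      by (auto simp: a_def b_def elim: eventually_mono)
    then have "AE x in M. A x powr s * B x powr (1 - s) = 0"
      by (rule eventually_mono) auto
    then have "(\<integral>x. A x powr s * B x powr (1 - s) \<partial>M) = (\<integral>x. 0 \<partial>M)"
      by (intro integral_cong_AE) auto
    then show ?thesis by simp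
  next
    case 2
    have pt: "A x powr s * B x powr (1 - s) \<le> a powr s * b powr (1 - s) * (s * (A x / a) + (1 - s) * (B x / b))" for x
    proof -
      have "A x powr s * B x powr (1 - s)
          = a powr s * b powr (1 - s) * ((A x / a) powr s * (B x / b) powr (1 - s))"
        using 2 A(2) B(2) by (simp add: powr_divide)
      also have "\<dots> \<le> a powr s * b powr (1 - s) * (s * (A x / a) + (1 - s) * (B x / b))"
        using 2 A(2) B(2) by (intro mult_left_mono young) auto
      finally show ?thesis .
    qed
    have I: "integrable M (\<lambda>x. a powr s * b powr (1 - s) * (s * (A x / a) + (1 - s) * (B x / b)))"
      using A(1) B(1) by auto
    have "(\<integral>x. A x powr s * B x powr (1 - s) \<partial>M)
        \<le> (\<integral>x. a powr s * b powr (1 - s) * (s * (A x / a) + (1 - s) * (B x / b)) \<partial>M)"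
      using 2 s A(2) B(2) by (intro integral_mono' I pt) auto
    also have "\<dots> = a powr s * b powr (1 - s) * (s * (a / a) + (1 - s) * (b / b))"
      using A(1) B(1) by (simp add: a_def b_def)
    also have "\<dots> = a powr s * b powr (1 - s)"
      using 2 by simp
    finally show ?thesis by (simp add: a_def b_def)
  qed
qed

section \<open>Powers of the norm and their gradients\<close>

lemma continuous_on_norm_powr_scaleR:
  fixes p :: real
  assumes "1 < p"
  shows "continuous_on UNIV (\<lambda>z::'a::real_normed_vector. norm z powr (p - 2) *\<^sub>R z)"
proof -
  have "isCont (\<lambda>z::'a. norm z powr (p - 2) *\<^sub>R z) z" for z
  proof (cases "z = 0")
    case True
    \<comment> \<open>For p < 2 the scalar factor blows up at the origin; the product still has norm
      |y|^(p-1), which tends to 0 because p > 1.\<close>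
    have eq: "norm (norm y powr (p - 2) *\<^sub>R y) = norm y powr (p - 1)" for y :: 'a
      by (cases "y = 0") (auto simp: powr_mult_base mult.commute)
    have "((\<lambda>y::'a. norm y powr (p - 1)) \<longlongrightarrow> 0) (at 0)"
      using assms by (intro tendsto_eq_intros | simp)+
    then have "((\<lambda>y::'a. norm y powr (p - 2) *\<^sub>R y) \<longlongrightarrow> 0) (at 0)"
      by (subst tendsto_norm_zero_iff[symmetric]) (simp only: eq)
    with True show ?thesis by (simp add: isCont_def)
  next
    case False
    then show ?thesis by (intro continuous_intros) auto
  qed
  then show ?thesis by (simp add: continuous_on_eq_continuous_at)
qed

text \<open>At the origin the quotient |y|^p / |y| = |y|^(p-1) tends to 0 because p > 1. Thus |f|^p
  is differentiable even at zeros of f, without regularisation.\<close>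

lemma has_derivative_norm_powr:
  fixes z :: "'a::real_inner"
  assumes "1 < p"
  shows "((\<lambda>z. norm z powr p) has_derivative (\<lambda>h. p * ((norm z powr (p - 2) *\<^sub>R z) \<bullet> h))) (at z)"
proof (cases "z = 0")
  case True
  have "((\<lambda>y::'a. norm y powr (p - 1)) \<longlongrightarrow> 0) (at 0)"
    using assms by (intro tendsto_eq_intros | simp)+
  moreover have "norm y powr (p - 1) = norm y powr p / norm y" for y :: 'a
    by (cases "y = 0") (auto simp: powr_diff)
  ultimately have "((\<lambda>y::'a. norm y powr p / norm y) \<longlongrightarrow> 0) (at 0)" by simp
  with True show ?thesis by (simp add: has_derivative_at)
next
  case False
  have "((\<lambda>z. norm z powr p) has_derivative
      (\<lambda>h. norm z powr p * (0 * ln (norm z) + (h \<bullet> sgn z) * p / norm z))) (at z)"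
    using False by (intro has_derivative_powr has_derivative_norm derivative_intros) auto
  moreover have "norm z powr p * (0 * ln (norm z) + (h \<bullet> sgn z) * p / norm z)
      = p * ((norm z powr (p - 2) *\<^sub>R z) \<bullet> h)" for h
    using False by (simp add: sgn_div_norm powr_diff inner_commute power2_eq_square field_simps)
  ultimately show ?thesis by simp
qed

section \<open>Left-invariant fields of a stratified group\<close>

lemma smooth_on_has_derivative:
  "smooth_on S f \<Longrightarrow> x \<in> S \<Longrightarrow> (f has_derivative frechet_derivative f (at x)) (at x)"
  unfolding smooth_on_def by (metis Ck_on.simps(2) frechet_derivative_works)

lemma smooth_on_derivative: "smooth_on S f \<Longrightarrow> smooth_on S (\<lambda>x. frechet_derivative f (at x) v)"
  unfolding smooth_on_def by (metis Ck_on.simps(2))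

lemma smooth_on_continuous: "smooth_on S f \<Longrightarrow> continuous_on S f"
  unfolding smooth_on_def by (metis Ck_on.simps(1))

lemma axis_coord: "x = (\<Sum>i\<in>UNIV. x $ i *\<^sub>R axis i 1)" for x :: "real^'n::finite"
  by (simp add: vec_eq_iff axis_def if_distrib cong: if_cong)

locale stratified =
  fixes gmul :: "real^'n \<Rightarrow> real^'n \<Rightarrow> real^'n" and deg :: "'n::finite \<Rightarrow> nat"
  assumes stratified: "stratified_group gmul deg"
begin

lemma gmul_0 [simp]: "gmul 0 x = x" "gmul x 0 = x"
  using stratified by (auto simp: stratified_group_def)

lemma smooth_gmul: "smooth_on UNIV (\<lambda>(x, y). gmul x y)"
  using stratified by (auto simp: stratified_group_def)

lemma deg_ge_1: "1 \<le> deg j"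
  using stratified by (auto simp: stratified_group_def)

lemma dil_gmul: "t > 0 \<Longrightarrow> dil deg t (gmul x y) = gmul (dil deg t x) (dil deg t y)"
  using stratified by (auto simp: stratified_group_def)

text \<open>Without coordinates of degree 1 there would be no generating fields, and the empty span
  cannot fill the tangent space at 0. The sharpness proof needs such a coordinate to centre a bump
  function.\<close>

lemma first_stratum_nonempty: "first_stratum deg \<noteq> {}"
proof
  assume "first_stratum deg = {}"
  then have "V \<notin> gen_fields gmul deg" for V
  proof -
    have False if "V \<in> gen_fields gmul deg"
      using that \<open>first_stratum deg = {}\<close> by induction auto
    then show ?thesis by blast
  qed
  then have empty: "{V (0 :: real^'n) | V. V \<in> gen_fields gmul deg} = {}" by auto
  have "span {V (0 :: real^'n) | V. V \<in> gen_fields gmul deg} = UNIV"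
    using stratified by (auto simp only: stratified_group_def)
  then have "span {} = (UNIV :: (real^'n) set)"
    by (simp only: empty)
  \<comment> \<open>The all-ones vector is nonzero because the index type is inhabited.\<close>
  then have "(1 :: real^'n) \<in> {0}" by (simp flip: span_empty)
  then show False by simp
qed

abbreviation gmul_deriv :: "(real^'n) \<times> (real^'n) \<Rightarrow> (real^'n) \<times> (real^'n) \<Rightarrow> real^'n" where
  "gmul_deriv z \<equiv> frechet_derivative (\<lambda>(x, y). gmul x y) (at z)"

lemma has_derivative_gmul_right: "(gmul x has_derivative (\<lambda>h. gmul_deriv (x, y) (0, h))) (at y)"
proof -
  have "((\<lambda>y. (\<lambda>(x, y). gmul x y) (x, y)) has_derivative (\<lambda>h. gmul_deriv (x, y) (0, h))) (at y)"
    by (rule has_derivative_compose[where f = "\<lambda>y. (x, y)" and g = "\<lambda>(x, y). gmul x y"])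
       (auto intro!: derivative_eq_intros smooth_on_has_derivative[OF smooth_gmul])
  then show ?thesis by simp
qed

text \<open>Writing the field through the joint derivative of the product at (x, 0) exposes its
  smooth dependence on x, from which existence and continuity of \<open>DX\<close> follow.\<close>

lemma Xfield_eq: "Xfield gmul j x = gmul_deriv (x, 0) (0, axis j 1)"
  unfolding Xfield_def by (simp flip: frechet_derivative_at[OF has_derivative_gmul_right])

abbreviation DX :: "'n \<Rightarrow> real^'n \<Rightarrow> real^'n \<Rightarrow> real^'n" where
  "DX j x \<equiv> frechet_derivative (Xfield gmul j) (at x)"

lemma has_derivative_Xfield_aux:
  "(Xfield gmul j has_derivative
     (\<lambda>h. frechet_derivative (\<lambda>z. gmul_deriv z (0, axis j 1)) (at (x, 0)) (h, 0))) (at x)"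
proof -
  have "((\<lambda>x. (\<lambda>z. gmul_deriv z (0, axis j 1)) (x, 0)) has_derivative
     (\<lambda>h. frechet_derivative (\<lambda>z. gmul_deriv z (0, axis j 1)) (at (x, 0)) (h, 0))) (at x)"
    by (rule has_derivative_compose[where f = "\<lambda>x. (x, 0)" and g = "\<lambda>z. gmul_deriv z (0, axis j 1)"])
       (auto intro!: derivative_eq_intros smooth_on_has_derivative[OF smooth_on_derivative[OF smooth_gmul]])
  moreover have "Xfield gmul j = (\<lambda>x. gmul_deriv (x, 0) (0, axis j 1))"
    by (simp add: fun_eq_iff Xfield_eq)
  ultimately show ?thesis by simp
qed

lemma has_derivative_Xfield: "(Xfield gmul j has_derivative DX j x) (at x)"
  unfolding frechet_derivative_at[OF has_derivative_Xfield_aux, symmetric] by (rule has_derivative_Xfield_aux)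

lemma continuous_on_DX: "continuous_on UNIV (\<lambda>x. DX j x v)"
proof -
  let ?H = "\<lambda>z. gmul_deriv z (0, axis j 1)"
  have "DX j x v = frechet_derivative ?H (at (x, 0)) (v, 0)" for x
    by (simp flip: frechet_derivative_at[OF has_derivative_Xfield_aux])
  moreover have "continuous_on UNIV (\<lambda>z. frechet_derivative ?H (at z) (v, 0))"
    by (intro smooth_on_continuous smooth_on_derivative smooth_gmul)
  then have "continuous_on UNIV (\<lambda>x. frechet_derivative ?H (at (x, 0)) (v, 0))"
    by (rule continuous_on_compose2) (auto intro!: continuous_intros)
  ultimately show ?thesis by simp
qed

section \<open>Homogeneity of the fields under dilations\<close>

lemma bounded_linear_dil: "bounded_linear (dil deg t)"
  unfolding dil_def
  by (rule linear_conv_bounded_linear[THEN iffD1], rule linearI)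
     (auto simp: vec_eq_iff algebra_simps)

lemma dil_axis: "dil deg t (axis k 1) = t ^ deg k *\<^sub>R axis k 1"
  by (auto simp: dil_def vec_eq_iff axis_def)

lemma Xfield_0: "Xfield gmul j 0 = axis j 1"
proof -
  have "gmul 0 = (\<lambda>x. x)" by auto
  then show ?thesis by (simp add: Xfield_def frechet_derivative_ident)
qed

text \<open>Differentiate the automorphism identity for \<open>dil deg t\<close> in the second
  argument at 0 along the j-th axis. Since \<open>deg j = 1\<close>, the dilation acts on this axis
  as multiplication by t.\<close>

lemma Xfield_dil:
  assumes "j \<in> first_stratum deg" "t > 0"
  shows "t *\<^sub>R Xfield gmul j (dil deg t x) = dil deg t (Xfield gmul j x)"
proof -
  have d: "(dil deg t has_derivative dil deg t) (at y)" for y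
    using bounded_linear_dil bounded_linear_imp_has_derivative by blast
  have 1: "((\<lambda>y. dil deg t (gmul x y)) has_derivative (\<lambda>h. dil deg t (gmul_deriv (x, 0) (0, h)))) (at 0)"
    by (rule has_derivative_compose[OF has_derivative_gmul_right d])
  have "dil deg t 0 = 0" by (simp add: dil_def vec_eq_iff)
  then have 2: "((\<lambda>y. gmul (dil deg t x) (dil deg t y)) has_derivative
      (\<lambda>h. gmul_deriv (dil deg t x, 0) (0, dil deg t h))) (at 0)"
    using has_derivative_compose[OF d[of 0] has_derivative_gmul_right] by simp
  have "gmul_deriv (dil deg t x, 0) (0, dil deg t (axis j 1)) = dil deg t (gmul_deriv (x, 0) (0, axis j 1))"
    using fun_cong[OF has_derivative_unique[OF 2[folded dil_gmul[OF assms(2)]] 1]] .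
  moreover have "deg j = 1" using assms by (simp add: first_stratum_def)
  then have "(0, dil deg t (axis j 1)) = t *\<^sub>R ((0, axis j 1) :: (real^'n) \<times> (real^'n))"
    by (simp add: dil_axis)
  moreover have "gmul_deriv (dil deg t x, 0) (t *\<^sub>R (0, axis j 1)) = t *\<^sub>R gmul_deriv (dil deg t x, 0) (0, axis j 1)"
    by (rule linear_scale[OF has_derivative_linear[OF smooth_on_has_derivative[OF smooth_gmul UNIV_I]]])
  ultimately show ?thesis
    by (simp only: Xfield_eq)
qed

text \<open>By \<open>Xfield_dil\<close> this partial derivative is homogeneous of degree \<open>deg i - 1 - deg k < 0\<close> and
  continuous at the origin.\<close>
lemma DX_axis_eq_0:
  assumes j: "j \<in> first_stratum deg" and le: "deg i \<le> deg k"
  shows "DX j x (axis k 1) $ i = 0"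
proof -
  \<comment> \<open>The subtraction is exact as \<open>deg i \<le> deg k\<close>, and the exponent
    is at least 1. Hence \<open>?e t\<close> tends to 0 as t decreases to 0, while
    \<open>hom\<close> shows that it does not depend on t.\<close>
  let ?e = "\<lambda>t. t ^ Suc (deg k - deg i) * DX j (dil deg t x) (axis k 1) $ i"
  have hom: "DX j x (axis k 1) $ i = ?e t" if t: "t > 0" for t
  proof -
    have d: "(dil deg t has_derivative dil deg t) (at y)" for y
      using bounded_linear_dil bounded_linear_imp_has_derivative by blast
    have 1: "((\<lambda>x. dil deg t (Xfield gmul j x)) has_derivative (\<lambda>h. dil deg t (DX j x h))) (at x)"
      by (rule has_derivative_compose[OF has_derivative_Xfield d])
    have 2: "((\<lambda>x. t *\<^sub>R Xfield gmul j (dil deg t x)) has_derivative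
        (\<lambda>h. t *\<^sub>R DX j (dil deg t x) (dil deg t h))) (at x)"
      by (intro has_derivative_scaleR_right has_derivative_compose[OF d has_derivative_Xfield])
    have "t *\<^sub>R DX j (dil deg t x) (dil deg t (axis k 1)) = dil deg t (DX j x (axis k 1))"
      using fun_cong[OF has_derivative_unique[OF 2[unfolded Xfield_dil[OF j t]] 1]] .
    then have "t *\<^sub>R (t ^ deg k *\<^sub>R DX j (dil deg t x) (axis k 1)) = dil deg t (DX j x (axis k 1))"
      using linear_scale[OF has_derivative_linear[OF has_derivative_Xfield]] by (simp add: dil_axis)
    then have "(t *\<^sub>R (t ^ deg k *\<^sub>R DX j (dil deg t x) (axis k 1))) $ i = dil deg t (DX j x (axis k 1)) $ i"
      by simp
    then have "t * (t ^ deg k * DX j (dil deg t x) (axis k 1) $ i) = t ^ deg i * DX j x (axis k 1) $ i"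
      by (simp add: dil_def)
    moreover have "t ^ deg k = t ^ deg i * t ^ (deg k - deg i)"
      using le by (simp flip: power_add)
    ultimately have "t ^ deg i * (t * (t ^ (deg k - deg i) * DX j (dil deg t x) (axis k 1) $ i))
        = t ^ deg i * DX j x (axis k 1) $ i"
      by (simp add: mult_ac)
    then show ?thesis using t by simp
  qed
  have "((\<lambda>t. dil deg t x) \<longlongrightarrow> dil deg 0 x) (at_right 0)"
    unfolding dil_def by (intro tendsto_intros)
  moreover have "isCont (\<lambda>y. DX j y (axis k 1)) (dil deg 0 x)"
    using continuous_on_DX by (simp add: continuous_on_eq_continuous_at)
  ultimately have "((\<lambda>t. DX j (dil deg t x) (axis k 1)) \<longlongrightarrow> DX j (dil deg 0 x) (axis k 1)) (at_right 0)"
    using isCont_tendsto_compose by blast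
  then have "(?e \<longlongrightarrow> 0 ^ Suc (deg k - deg i) * DX j (dil deg 0 x) (axis k 1) $ i) (at_right 0)"
    by (intro tendsto_intros)
  then have "(?e \<longlongrightarrow> 0) (at_right 0)" by simp
  moreover have "eventually (\<lambda>t. ?e t = DX j x (axis k 1) $ i) (at_right 0)"
    using hom by (simp add: eventually_at_right_less eventually_at_filter)
  ultimately have "((\<lambda>_::real. DX j x (axis k 1) $ i) \<longlongrightarrow> 0) (at_right 0)"
    by (rule Lim_transform_eventually)
  then show ?thesis by (simp add: tendsto_const_iff)
qed

text \<open>A first-stratum component has the least possible degree, so \<open>DX_axis_eq_0\<close>
  kills all its partial derivatives. It is constant, and its value is read off at the
  identity.\<close>

lemma Xfield_first_stratum:
  assumes "j \<in> first_stratum deg" "i \<in> first_stratum deg"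
  shows "Xfield gmul j x $ i = (if i = j then 1 else 0)"
proof -
  have "DX j x h $ i = 0" for x h
  proof -
    have "DX j x h = DX j x (\<Sum>k\<in>UNIV. h $ k *\<^sub>R axis k 1)" by (simp flip: axis_coord)
    also have "\<dots> = (\<Sum>k\<in>UNIV. h $ k *\<^sub>R DX j x (axis k 1))"
      using has_derivative_linear[OF has_derivative_Xfield, of j x] by (simp add: linear_sum linear_scale)
    finally show ?thesis
      using DX_axis_eq_0[OF assms(1)] assms(2) deg_ge_1 by (simp add: first_stratum_def)
  qed
  then have "((\<lambda>x. Xfield gmul j x $ i) has_derivative (\<lambda>h. 0)) (at x within UNIV)" for x
    using bounded_linear.has_derivative[OF bounded_linear_vec_nth has_derivative_Xfield[of j x], of i] by simp
  then obtain c where "\<And>x. Xfield gmul j x $ i = c"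
    using has_derivative_zero_constant[of UNIV "\<lambda>x. Xfield gmul j x $ i"] by auto
  then have "Xfield gmul j x $ i = Xfield gmul j 0 $ i" by simp
  then show ?thesis by (simp add: Xfield_0 axis_def)
qed

section \<open>The radial field and its divergence\<close>

definition radial_field :: "real^'n \<Rightarrow> real^'n" where
  "radial_field x = (\<Sum>j\<in>first_stratum deg. x $ j *\<^sub>R Xfield gmul j x)"

definition radial_deriv :: "real^'n \<Rightarrow> real^'n \<Rightarrow> real^'n" where
  "radial_deriv x h = (\<Sum>j\<in>first_stratum deg. x $ j *\<^sub>R DX j x h + h $ j *\<^sub>R Xfield gmul j x)"

lemma has_derivative_radial_field: "(radial_field has_derivative radial_deriv x) (at x)"
proof -
  have "((\<lambda>x. \<Sum>j\<in>first_stratum deg. x $ j *\<^sub>R Xfield gmul j x) has_derivative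
     (\<lambda>h. \<Sum>j\<in>first_stratum deg. x $ j *\<^sub>R DX j x h + h $ j *\<^sub>R Xfield gmul j x)) (at x)"
    by (intro has_derivative_sum has_derivative_scaleR has_derivative_Xfield
        bounded_linear_imp_has_derivative[OF bounded_linear_vec_nth])
  then show ?thesis by (simp add: radial_field_def[abs_def] radial_deriv_def[abs_def])
qed

lemma continuous_on_Xfield: "continuous_on S (Xfield gmul j)"
  by (rule has_derivative_continuous_on[OF has_derivative_at_withinI[OF has_derivative_Xfield]])

lemma continuous_on_radial_field: "continuous_on S radial_field"
  by (rule has_derivative_continuous_on[OF has_derivative_at_withinI[OF has_derivative_radial_field]])

lemma continuous_on_radial_deriv: "continuous_on UNIV (\<lambda>x. radial_deriv x v)"
  unfolding radial_deriv_def
  by (intro continuous_intros continuous_on_DX continuous_on_Xfield)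

lemma radial_field_first_stratum: "i \<in> first_stratum deg \<Longrightarrow> radial_field x $ i = x $ i"
  by (simp add: radial_field_def Xfield_first_stratum if_distrib[of "(*) _"] cong: if_cong)

text \<open>The product rule gives two kinds of terms. Those with \<open>DX\<close> vanish by the
  diagonal case of \<open>DX_axis_eq_0\<close>; the others add up the j-th component of each X_j,
  which is 1.\<close>

lemma divergence_radial_field: "(\<Sum>i\<in>UNIV. radial_deriv x (axis i 1) $ i) = real (Ndim deg)"
proof -
  have "(\<Sum>i\<in>UNIV. radial_deriv x (axis i 1) $ i)
      = (\<Sum>i\<in>UNIV. \<Sum>j\<in>first_stratum deg. axis i 1 $ j * Xfield gmul j x $ i)"
    by (simp add: radial_deriv_def DX_axis_eq_0)
  also have "\<dots> = (\<Sum>j\<in>first_stratum deg. \<Sum>i\<in>UNIV. axis i 1 $ j * Xfield gmul j x $ i)"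
    by (rule sum.swap)
  also have "\<dots> = (\<Sum>j\<in>first_stratum deg. 1)"
  proof (rule sum.cong)
    fix j assume j: "j \<in> first_stratum deg"
    have "(\<Sum>i\<in>UNIV. axis i 1 $ j * Xfield gmul j x $ i)
        = (\<Sum>i\<in>UNIV. if i = j then Xfield gmul j x $ i else 0)"
      by (rule sum.cong) (auto simp: axis_def)
    also have "\<dots> = 1"
      using j by (simp add: Xfield_first_stratum)
    finally show "(\<Sum>i\<in>UNIV. axis i 1 $ j * Xfield gmul j x $ i) = 1" .
  qed simp
  finally show ?thesis by (simp add: Ndim_def)
qed

end

section \<open>Bump functions\<close>

text \<open>The classical function exp(-1/t), extended by 0. The extra powers of 1/t make the span
  of the family closed under differentiation.\<close>

definition flat :: "nat \<Rightarrow> real \<Rightarrow> real" where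
  "flat m t = (if t > 0 then inverse t ^ m * exp (- inverse t) else 0)"

lemma flat_has_real_derivative:
  "(flat m has_real_derivative flat (m + 2) t - real m * flat (m + 1) t) (at t)"
proof -
  consider "t > 0" | "t < 0" | "t = 0" by linarith
  then show ?thesis
  proof cases
    case 1
    have "((\<lambda>t. inverse t ^ m) has_real_derivative
        real m * (- (inverse t ^ Suc (Suc 0)) * inverse t ^ (m - Suc 0))) (at t)"
      using 1 by (intro DERIV_power DERIV_inverse) simp
    \<comment> \<open>For m = 0 the truncated exponent \<open>m - Suc 0\<close> is harmless, as the
      factor \<open>real m\<close> is 0.\<close>
    also have "real m * (- (inverse t ^ Suc (Suc 0)) * inverse t ^ (m - Suc 0)) = - real m * inverse t ^ (m + 1)"
      by (cases m) (simp_all add: algebra_simps)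
    finally have pow: "((\<lambda>t. inverse t ^ m) has_real_derivative - real m * inverse t ^ (m + 1)) (at t)" .
    have "((\<lambda>t. exp (- inverse t)) has_real_derivative exp (- inverse t) * inverse t ^ 2) (at t)"
      using 1 by (auto intro!: derivative_eq_intros simp: power2_eq_square field_simps)
    from DERIV_mult[OF pow this]
    have "((\<lambda>t. inverse t ^ m * exp (- inverse t)) has_real_derivative
        flat (m + 2) t - real m * flat (m + 1) t) (at t)"
      using 1 by (simp add: flat_def power_add power2_eq_square algebra_simps)
    then show ?thesis
      by (rule has_field_derivative_transform_within_open[of _ _ _ "{0<..}"])
         (use 1 in \<open>auto simp: flat_def\<close>)
  next
    case 2
    have "((\<lambda>t. 0) has_real_derivative 0) (at t)" by simp
    then have "(flat m has_real_derivative 0) (at t)"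
      by (rule has_field_derivative_transform_within_open[of _ _ _ "{..<0}"])
         (use 2 in \<open>auto simp: flat_def\<close>)
    with 2 show ?thesis by (simp add: flat_def)
  next
    case 3
    \<comment> \<open>With s = 1/t the right-hand quotient is s^(m+1) exp(-s), which tends to 0 as s
      grows; on the left the quotient is identically 0.\<close>
    have "((\<lambda>t. inverse t ^ Suc m / exp (inverse t)) \<longlongrightarrow> 0) (at_right (0::real))"
      by (rule filterlim_compose[OF tendsto_power_div_exp_0 filterlim_inverse_at_top_right])
    then have "((\<lambda>t. flat m t / t) \<longlongrightarrow> 0) (at_right 0)"
      by (rule Lim_transform_eventually)
         (auto simp: eventually_at_filter flat_def exp_minus field_simps)
    moreover have "((\<lambda>t. flat m t / t) \<longlongrightarrow> 0) (at_left 0)"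
      by (rule tendsto_eventually) (auto simp: eventually_at_filter flat_def)
    ultimately have "((\<lambda>t. flat m t / t) \<longlongrightarrow> 0) (at 0)"
      by (simp add: filterlim_split_at)
    with 3 show ?thesis by (simp add: has_field_derivative_iff flat_def)
  qed
qed

text \<open>An algebra of functions that contains the bump functions centred at \<open>a\<close> and is closed under
  directional derivatives, so that smoothness follows by induction on the order.\<close>
inductive_set bump_algebra :: "'a::real_inner \<Rightarrow> ('a \<Rightarrow> complex) set" for a where
  flat: "(\<lambda>x. complex_of_real (flat m (1/4 - (x - a) \<bullet> (x - a)))) \<in> bump_algebra a"
| const: "(\<lambda>x. c) \<in> bump_algebra a"
| lin: "(\<lambda>x. complex_of_real ((x - a) \<bullet> v)) \<in> bump_algebra a"
| add: "f \<in> bump_algebra a \<Longrightarrow> g \<in> bump_algebra a \<Longrightarrow> (\<lambda>x. f x + g x) \<in> bump_algebra a"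
| mult: "f \<in> bump_algebra a \<Longrightarrow> g \<in> bump_algebra a \<Longrightarrow> (\<lambda>x. f x * g x) \<in> bump_algebra a"

text \<open>By the chain rule, differentiating a \<open>flat\<close> generator produces other
  \<open>flat\<close> generators times -2 (x-a).v; this is why constants and the linear functions
  are among the generators.\<close>

lemma bump_algebra_derivative:
  assumes "f \<in> bump_algebra a"
  shows "\<exists>f'. (\<forall>x. (f has_derivative f' x) (at x)) \<and> (\<forall>v. (\<lambda>x. f' x v) \<in> bump_algebra a)"
  using assms
proof induction
  case (flat m)
  define g where "g = (\<lambda>x. 1/4 - (x - a) \<bullet> (x - a))"
  \<comment> \<open>The difference is written as a sum with the constant \<open>- of_nat m\<close>,
    so that the introduction rules of the algebra match literally.\<close>
  define f' where "f' = (\<lambda>x v. (complex_of_real (flat (m + 2) (g x)) + (- of_nat m) * complex_of_real (flat (m + 1) (g x)))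
      * ((-2) * complex_of_real ((x - a) \<bullet> v)))"
  have "((\<lambda>x. complex_of_real (flat m (g x))) has_derivative f' x) (at x)" for x
  proof -
    have "(g has_derivative (\<lambda>v. - 2 * ((x - a) \<bullet> v))) (at x)"
      unfolding g_def by (auto intro!: derivative_eq_intros simp: inner_commute)
    moreover have "(flat m has_derivative (*) (flat (m + 2) (g x) - real m * flat (m + 1) (g x))) (at (g x))"
      using flat_has_real_derivative by (simp add: has_field_derivative_def)
    ultimately have "((\<lambda>x. flat m (g x)) has_derivative
        (\<lambda>v. (flat (m + 2) (g x) - real m * flat (m + 1) (g x)) * (- 2 * ((x - a) \<bullet> v)))) (at x)"
      by (rule has_derivative_compose)
    from bounded_linear.has_derivative[OF bounded_linear_of_real[where 'a = complex] this]
    show ?thesis by (simp add: f'_def algebra_simps)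
  qed
  moreover have "(\<lambda>x. f' x v) \<in> bump_algebra a" for v
    unfolding f'_def g_def
    by (intro bump_algebra.intros)
  ultimately show ?case unfolding g_def by blast
next
  case (const c)
  show ?case
    by (rule exI[of _ "\<lambda>_ _. 0"]) (auto intro: bump_algebra.const)
next
  case (lin v)
  have "((\<lambda>x. complex_of_real ((x - a) \<bullet> v)) has_derivative (\<lambda>h. complex_of_real (h \<bullet> v))) (at x)" for x
    by (auto intro!: derivative_eq_intros)
  then show ?case
    by (intro exI[of _ "\<lambda>_ h. complex_of_real (h \<bullet> v)"]) (auto intro: bump_algebra.const)
next
  case (add f g)
  then obtain f' g' where "\<forall>x. (f has_derivative f' x) (at x)" "\<forall>v. (\<lambda>x. f' x v) \<in> bump_algebra a"
    "\<forall>x. (g has_derivative g' x) (at x)" "\<forall>v. (\<lambda>x. g' x v) \<in> bump_algebra a"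
    by blast
  then show ?case
    by (intro exI[of _ "\<lambda>x v. f' x v + g' x v"]) (auto intro: bump_algebra.add has_derivative_add)
next
  case (mult f g)
  then obtain f' g' where "\<forall>x. (f has_derivative f' x) (at x)" "\<forall>v. (\<lambda>x. f' x v) \<in> bump_algebra a"
    "\<forall>x. (g has_derivative g' x) (at x)" "\<forall>v. (\<lambda>x. g' x v) \<in> bump_algebra a"
    by blast
  with mult.hyps show ?case
    by (intro exI[of _ "\<lambda>x v. f x * g' x v + f' x v * g x"])
       (intro conjI allI has_derivative_mult bump_algebra.add bump_algebra.mult; blast)
qed

lemma bump_algebra_Ck_on:
  fixes f :: "'a::real_inner \<Rightarrow> complex"
  shows "f \<in> bump_algebra a \<Longrightarrow> Ck_on k S f"
proof (induction k arbitrary: f)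
  case 0
  then obtain f' where "\<And>x. (f has_derivative f' x) (at x)"
    using bump_algebra_derivative by blast
  then have "continuous_on S f"
    by (rule has_derivative_continuous_on[OF has_derivative_at_withinI])
  then show ?case by simp
next
  case (Suc k)
  then obtain f' where f': "\<And>x. (f has_derivative f' x) (at x)" "\<And>v. (\<lambda>x. f' x v) \<in> bump_algebra a"
    using bump_algebra_derivative by blast
  have "frechet_derivative f (at x) = f' x" for x
    using frechet_derivative_at[OF f'(1)] ..
  with f' Suc.IH show ?case
    by (auto simp: differentiable_def)
qed

section \<open>A bump test function supported away from x' = 0\<close>

lemma abs_coord_le_xnorm:
  assumes "j \<in> first_stratum deg"
  shows "\<bar>x $ j\<bar> \<le> xnorm deg x"
proof -
  have "(x $ j)\<^sup>2 \<le> (\<Sum>j\<in>first_stratum deg. (x $ j)\<^sup>2)"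
    using assms by (intro member_le_sum) auto
  then have "sqrt ((x $ j)\<^sup>2) \<le> xnorm deg x"
    unfolding xnorm_def by (rule real_sqrt_le_mono)
  then show ?thesis by simp
qed

text \<open>The centre has j-th coordinate 1 and the radius is 1/2, with square 1/4. On the closed
  ball x_j therefore stays at least 1/2, which keeps |x'| away from 0.\<close>

lemma test_fun_bump:
  fixes deg :: "'n::finite \<Rightarrow> nat"
  assumes j: "j \<in> first_stratum deg"
  shows "(\<lambda>x. complex_of_real (flat 0 (1/4 - (x - axis j 1) \<bullet> (x - axis j 1)))) \<in> test_funs deg" (is "?f \<in> _")
    and "dist x (axis j 1) < 1/2 \<Longrightarrow> xnorm deg x \<noteq> 0"
    and "dist x (axis j 1) < 1/2 \<Longrightarrow> flat 0 (1/4 - (x - axis j 1) \<bullet> (x - axis j 1)) > 0"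
proof -
  have sq: "(x - axis j 1) \<bullet> (x - axis j 1) = (dist x (axis j 1))\<^sup>2" for x :: "real^'n"
    by (simp add: dist_norm power2_norm_eq_inner)
  have ne: "xnorm deg x \<noteq> 0" if "dist x (axis j 1) \<le> 1/2" for x
  proof -
    have "\<bar>(x - axis j 1) $ j\<bar> \<le> 1/2"
      using component_le_norm_cart[of "x - axis j 1" j] that by (simp add: dist_norm)
    then have "\<bar>x $ j - 1\<bar> \<le> 1/2" by (simp add: axis_def)
    then have "\<bar>x $ j\<bar> > 0" by linarith
    then show ?thesis using abs_coord_le_xnorm[OF j, of x] by linarith
  qed
  have "?f x = 0" if "x \<notin> cball (axis j 1) (1/2)" for x
  proof -
    have "(1/2)\<^sup>2 < (dist x (axis j 1))\<^sup>2"
      using that by (intro power_strict_mono) (auto simp: dist_commute)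
    then show ?thesis by (simp add: sq flat_def power2_eq_square)
  qed
  moreover have "cball (axis j 1) (1/2) \<subseteq> {x. xnorm deg x \<noteq> 0}"
    using ne by (auto simp: dist_commute)
  moreover have "smooth_on {x. xnorm deg x \<noteq> 0} ?f"
    unfolding smooth_on_def by (intro allI bump_algebra_Ck_on[OF bump_algebra.flat])
  ultimately show "?f \<in> test_funs deg"
    unfolding test_funs_def using compact_cball by blast
  show "dist x (axis j 1) < 1/2 \<Longrightarrow> xnorm deg x \<noteq> 0" using ne by simp
  assume "dist x (axis j 1) < 1/2"
  then have "(dist x (axis j 1))\<^sup>2 < (1/2)\<^sup>2"
    by (intro power_strict_mono) auto
  then show "flat 0 (1/4 - (x - axis j 1) \<bullet> (x - axis j 1)) > 0"
    by (simp add: sq flat_def power2_eq_square)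
qed

section \<open>The divergence theorem for the radial field\<close>

text \<open>\<open>U\<close> and the complement of \<open>K\<close> are open and cover the space.
  This extends functions with weights that are singular at x' = 0.\<close>

lemma continuous_on_UNIV_if_compact_support:
  fixes g :: "'a::t2_space \<Rightarrow> 'b::real_normed_vector"
  assumes "open U" "compact K" "K \<subseteq> U" "continuous_on U g" "\<And>x. x \<notin> K \<Longrightarrow> g x = 0"
  shows "continuous_on UNIV g"
proof -
  have "continuous_on (- K) g"
    using assms(5) by (subst continuous_on_cong[of _ "- K" _ "\<lambda>_. 0"]) auto
  then have "continuous_on (U \<union> - K) g"
    using assms compact_imp_closed by (intro continuous_on_open_Un) auto
  moreover have "U \<union> - K = UNIV" using assms(3) by auto
  ultimately show ?thesis by simp
qed

lemma has_derivative_zero_outside_closed: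
  assumes "closed K" "\<And>x. x \<notin> K \<Longrightarrow> f x = 0" "x \<notin> K"
  shows "(f has_derivative (\<lambda>_. 0)) (at x)"
  by (rule has_derivative_transform_within_open[of "\<lambda>_. 0" _ _ _ "- K"]) (use assms in auto)

lemma xnorm_nonneg: "xnorm deg x \<ge> 0"
  by (simp add: xnorm_def sum_nonneg)

lemma continuous_on_xnorm: "continuous_on S (xnorm deg)"
  unfolding xnorm_def[abs_def] by (intro continuous_intros)

lemma open_xnorm_nonzero: "open {x. xnorm deg x \<noteq> 0}"
  by (intro open_Collect_neq continuous_on_xnorm continuous_on_const)

text \<open>Chain rule for the power a/2 of |x'|^2, avoiding the square root.\<close>

lemma has_derivative_xnorm_powr:
  assumes "xnorm deg x \<noteq> 0"
  shows "((\<lambda>x. xnorm deg x powr a) has_derivative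
     (\<lambda>h. a * xnorm deg x powr (a - 2) * (\<Sum>j\<in>first_stratum deg. x $ j * h $ j))) (at x)"
proof -
  let ?Q = "\<lambda>x. \<Sum>j\<in>first_stratum deg. (x $ j)\<^sup>2"
  have pos: "xnorm deg x > 0" using assms xnorm_nonneg[of deg x] by simp
  then have Qpos: "?Q x > 0" by (simp add: xnorm_def)
  have Q: "(?Q has_derivative (\<lambda>h. 2 * (\<Sum>j\<in>first_stratum deg. x $ j * h $ j))) (at x)"
    by (auto intro!: derivative_eq_intros bounded_linear_imp_has_derivative[OF bounded_linear_vec_nth]
        simp: sum_distrib_left mult_ac)
  have "((\<lambda>x. ?Q x powr (a / 2)) has_derivative
      (\<lambda>h. ?Q x powr (a / 2) * (0 * ln (?Q x) + 2 * (\<Sum>j\<in>first_stratum deg. x $ j * h $ j) * (a / 2) / ?Q x))) (at x)"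
    by (rule has_derivative_powr[OF Q has_derivative_const Qpos]) simp
  moreover have eq: "xnorm deg y powr a = ?Q y powr (a / 2)" for y a
    by (simp add: xnorm_def powr_half_sqrt[symmetric] sum_nonneg powr_powr)
  moreover have "?Q x powr ((a - 2) / 2) = ?Q x powr (a / 2) / ?Q x"
    using Qpos by (simp add: diff_divide_distrib powr_diff)
  ultimately show ?thesis by (simp add: mult_ac)
qed

text \<open>For d = 0 all factors are 1 by the convention of \<open>rpow\<close>, even if
  \<open>k\<close> or \<open>A\<close> is 0; otherwise these are the laws of
  \<open>powr\<close>.\<close>

lemma rpow_mult_powr:
  assumes "k \<ge> 0" "A \<ge> 0" "0 < p"
  shows "rpow (k powr p * A) (d / p) = rpow k d * rpow A (d / p)"
  using assms by (auto simp: rpow_def powr_mult powr_powr)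

text \<open>Here \<xi> - \<eta> = -k u, so the last term of \<open>Cp\<close> splits into a multiple
  of |u|^p and a cross term. The cross term is the one that the divergence identity
  evaluates.\<close>

lemma Cp_add_scaled:
  assumes "1 < p"
  shows "Cp p \<xi> (\<xi> + complex_of_real k * u)
     = cmod \<xi> powr p + (p - 1) * \<bar>k\<bar> powr p * cmod u powr p
       + k * \<bar>k\<bar> powr (p - 2) * (p * ((cmod u powr (p - 2) *\<^sub>R u) \<bullet> \<xi>))"
proof (cases "k = 0 \<or> u = 0")
  \<comment> \<open>Now \<xi> = \<eta>: the last term of \<open>Cp\<close> takes its default value
    0, and all terms with \<open>k\<close> and \<open>u\<close> vanish because
    \<open>0 powr _ = 0\<close>.\<close>
  case True
  then show ?thesis by (auto simp: Cp_def)
next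
  case False
  then have ne: "\<xi> \<noteq> \<xi> + complex_of_real k * u" by simp
  have inner: "Re (u * cnj \<xi>) = u \<bullet> \<xi>"
    by (simp add: inner_complex_def)
  have re: "Re ((\<xi> - (\<xi> + complex_of_real k * u)) * cnj (\<xi> + complex_of_real k * u))
      = - k * (u \<bullet> \<xi>) - k\<^sup>2 * (cmod u)\<^sup>2"
    unfolding inner[symmetric] cmod_power2
    by (simp add: algebra_simps power2_eq_square)
  have mod: "cmod (\<xi> - (\<xi> + complex_of_real k * u)) = \<bar>k\<bar> * cmod u"
    by (simp add: norm_mult)
  have sq: "(\<bar>k\<bar> * cmod u) powr (p - 2) * (k\<^sup>2 * (cmod u)\<^sup>2) = \<bar>k\<bar> powr p * cmod u powr p"
  proof -
    have "(\<bar>k\<bar> * cmod u) powr (p - 2) * (\<bar>k\<bar> * cmod u)\<^sup>2 = (\<bar>k\<bar> * cmod u) powr p"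
      using False by (simp add: powr_diff)
    then show ?thesis by (simp add: powr_mult power_mult_distrib)
  qed
  have "Cp p \<xi> (\<xi> + complex_of_real k * u) = cmod \<xi> powr p - (\<bar>k\<bar> * cmod u) powr p
      - p * (\<bar>k\<bar> * cmod u) powr (p - 2) * (- k * (u \<bullet> \<xi>) - k\<^sup>2 * (cmod u)\<^sup>2)"
    unfolding Cp_def re mod using ne by (simp only: if_False)
  also have "\<dots> = cmod \<xi> powr p - (\<bar>k\<bar> * cmod u) powr p + p * k * (\<bar>k\<bar> * cmod u) powr (p - 2) * (u \<bullet> \<xi>)
      + p * ((\<bar>k\<bar> * cmod u) powr (p - 2) * (k\<^sup>2 * (cmod u)\<^sup>2))"
    by (simp add: algebra_simps)
  finally show ?thesis
    unfolding sq by (simp add: powr_mult algebra_simps)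
qed

context stratified
begin

text \<open>The field \<Phi> R has compact support and divergence R \<Phi> + N \<Phi>, whose
  integral is 0.\<close>

lemma integral_radial_derivative:
  fixes \<Phi> :: "real^'n \<Rightarrow> real"
  assumes der: "\<And>x. (\<Phi> has_derivative \<Phi>' x) (at x)"
    and cont: "\<And>v. continuous_on UNIV (\<lambda>x. \<Phi>' x v)"
    and K: "compact K" "\<And>x. x \<notin> K \<Longrightarrow> \<Phi> x = 0"
  shows "(\<integral>x. \<Phi>' x (radial_field x) \<partial>lborel) = - real (Ndim deg) * (\<integral>x. \<Phi> x \<partial>lborel)"
proof -
  have \<Phi>cont: "continuous_on S \<Phi>" for S
    by (rule has_derivative_continuous_on[OF has_derivative_at_withinI[OF der]])
  have cont': "continuous_on S (\<lambda>x. \<Phi>' x v)" for S v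
    using cont continuous_on_subset by blast
  have rcont': "continuous_on S (\<lambda>x. radial_deriv x v)" for S v
    using continuous_on_radial_deriv continuous_on_subset by blast
  have \<Phi>'0: "\<Phi>' x = (\<lambda>_. 0)" if "x \<notin> K" for x
    using has_derivative_unique[OF der has_derivative_zero_outside_closed[OF compact_imp_closed[OF K(1)] K(2) that]]
    by simp
  have expand: "\<Phi>' x (radial_field x) = (\<Sum>i\<in>UNIV. radial_field x $ i * \<Phi>' x (axis i 1))" for x
  proof -
    have "\<Phi>' x (radial_field x) = \<Phi>' x (\<Sum>i\<in>UNIV. radial_field x $ i *\<^sub>R axis i 1)"
      by (simp flip: axis_coord)
    also have "\<dots> = (\<Sum>i\<in>UNIV. radial_field x $ i *\<^sub>R \<Phi>' x (axis i 1))"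
      using has_derivative_linear[OF der, of x] by (simp add: linear_sum linear_scale)
    finally show ?thesis by simp
  qed
  \<comment> \<open>\<open>g i x\<close> is the derivative of the i-th component of \<Phi> R;
    evaluating along axis i and summing over i yields the divergence.\<close>
  define g where "g = (\<lambda>i x h. \<Phi> x * radial_deriv x h $ i + \<Phi>' x h * radial_field x $ i)"
  have gcont: "continuous_on S (\<lambda>x. g i x h)" for S i h
    unfolding g_def by (intro continuous_intros \<Phi>cont cont' rcont' continuous_on_radial_field)
  have zero: "(\<integral>x. g i x (axis i 1) \<partial>lborel) = 0" for i
  proof (rule integral_directional_derivative_eq_0[OF _ gcont K(1)])
    show "((\<lambda>x. \<Phi> x * radial_field x $ i) has_derivative g i x) (at x)" for x
      unfolding g_def
      by (rule has_derivative_mult[OF der bounded_linear.has_derivative[OF bounded_linear_vec_nth has_derivative_radial_field]])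
  qed (simp add: K)
  have gint: "integrable lborel (\<lambda>x. g i x (axis i 1))" for i
    by (rule integrable_compact_support[OF K(1) gcont]) (simp add: g_def K \<Phi>'0)
  have \<Phi>int: "integrable lborel \<Phi>"
    by (rule integrable_compact_support[OF K(1) \<Phi>cont K(2)])
  have Rint: "integrable lborel (\<lambda>x. \<Phi>' x (radial_field x))"
    unfolding expand
    by (rule integrable_compact_support[OF K(1)])
       (auto intro!: continuous_intros cont' continuous_on_radial_field simp: \<Phi>'0)
  have "(\<Sum>i\<in>UNIV. g i x (axis i 1)) = real (Ndim deg) * \<Phi> x + \<Phi>' x (radial_field x)" for x
    by (simp add: g_def sum.distrib expand mult_ac flip: sum_distrib_left divergence_radial_field[of x])
  then have "(\<integral>x. real (Ndim deg) * \<Phi> x + \<Phi>' x (radial_field x) \<partial>lborel) = (\<integral>x. (\<Sum>i\<in>UNIV. g i x (axis i 1)) \<partial>lborel)"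
    by simp
  also have "\<dots> = 0"
    by (simp add: gint zero)
  finally show ?thesis
    using \<Phi>int Rint by simp
qed

text \<open>Inserted into \<open>has_derivative_xnorm_powr\<close>, this gives R |x'|^a = a
  |x'|^a.\<close>

lemma sum_first_stratum_radial_field:
  "(\<Sum>j\<in>first_stratum deg. x $ j * radial_field x $ j) = (xnorm deg x)\<^sup>2"
  by (simp add: radial_field_first_stratum xnorm_def sum_nonneg power2_eq_square)

end

section \<open>The weighted inequality\<close>

locale stratified_test_fun = stratified gmul deg
  for gmul :: "real^'n \<Rightarrow> real^'n \<Rightarrow> real^'n" and deg :: "'n::finite \<Rightarrow> nat" +
  fixes f :: "real^'n \<Rightarrow> complex" and K :: "(real^'n) set"
  assumes smooth_f: "smooth_on {x. xnorm deg x \<noteq> 0} f"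
    and compact_K: "compact K"
    and K_subset: "K \<subseteq> {x. xnorm deg x \<noteq> 0}"
    and f_eq_0: "x \<notin> K \<Longrightarrow> f x = 0"
begin

abbreviation Df :: "real^'n \<Rightarrow> real^'n \<Rightarrow> complex" where
  "Df x \<equiv> frechet_derivative f (at x)"

lemma Df_eq_0: "x \<notin> K \<Longrightarrow> Df x = (\<lambda>_. 0)"
  by (rule frechet_derivative_at[OF has_derivative_zero_outside_closed
        [OF compact_imp_closed[OF compact_K] f_eq_0], symmetric])

text \<open>Smoothness is given only where x' is nonzero. Every other point lies in the open
  complement of \<open>K\<close>, where f is identically 0.\<close>

lemma has_derivative_f: "(f has_derivative Df x) (at x)"
proof (cases "x \<in> K")
  case True
  then show ?thesis using K_subset by (intro smooth_on_has_derivative[OF smooth_f]) auto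
next
  case False
  then show ?thesis
    using has_derivative_zero_outside_closed[OF compact_imp_closed[OF compact_K] f_eq_0 False] by (simp add: Df_eq_0)
qed

lemma continuous_on_f: "continuous_on S f"
  by (rule has_derivative_continuous_on[OF has_derivative_at_withinI[OF has_derivative_f]])

lemma continuous_on_Df: "continuous_on S (\<lambda>x. Df x v)"
proof -
  have "continuous_on UNIV (\<lambda>x. Df x v)"
    by (rule continuous_on_UNIV_if_compact_support[OF open_xnorm_nonzero compact_K K_subset
          smooth_on_continuous[OF smooth_on_derivative[OF smooth_f]]])
       (simp add: Df_eq_0)
  then show ?thesis using continuous_on_subset by blast
qed

lemma radial_H_eq: "radial_H gmul deg f x = Df x (radial_field x)"
proof -
  have "Df x (radial_field x) = (\<Sum>j\<in>first_stratum deg. x $ j *\<^sub>R Df x (Xfield gmul j x))"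
    using has_derivative_linear[OF has_derivative_f, of x]
    by (simp add: radial_field_def linear_sum linear_scale)
  then show ?thesis by (simp add: radial_H_def Xop_def scaleR_conv_of_real)
qed

lemma continuous_on_radial_H: "continuous_on S (radial_H gmul deg f)"
proof -
  \<comment> \<open>Continuity of \<open>Df\<close> is available for fixed directions only, so the
    moving direction is expanded in coordinates.\<close>
  have "radial_H gmul deg f x = (\<Sum>i\<in>UNIV. radial_field x $ i *\<^sub>R Df x (axis i 1))" for x
  proof -
    have "Df x (radial_field x) = Df x (\<Sum>i\<in>UNIV. radial_field x $ i *\<^sub>R axis i 1)"
      by (simp flip: axis_coord)
    then show ?thesis
      using has_derivative_linear[OF has_derivative_f, of x] by (simp add: linear_sum linear_scale radial_H_eq)
  qed
  moreover have "continuous_on S (\<lambda>x. \<Sum>i\<in>UNIV. radial_field x $ i *\<^sub>R Df x (axis i 1))"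
    by (intro continuous_intros continuous_on_Df continuous_on_radial_field)
  ultimately show ?thesis by presburger
qed

lemma radial_H_eq_0: "x \<notin> K \<Longrightarrow> radial_H gmul deg f x = 0"
  by (simp add: radial_H_eq Df_eq_0)

section \<open>Weighted integrals and the evaluation of the bracket\<close>

lemma continuous_on_xnorm_powr: "continuous_on {x. xnorm deg x \<noteq> 0} (\<lambda>x. xnorm deg x powr a)"
  by (intro continuous_on_powr continuous_on_xnorm continuous_on_const) simp

lemma continuous_on_norm_f_powr:
  assumes "1 < p"
  shows "continuous_on S (\<lambda>x. norm (f x) powr (p - 2) *\<^sub>R f x)"
  by (rule continuous_on_compose2[OF continuous_on_norm_powr_scaleR[OF assms] continuous_on_f]) simp

lemma integrable_weighted:
  fixes g :: "real^'n \<Rightarrow> complex"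
  assumes "continuous_on K g" "\<And>x. x \<notin> K \<Longrightarrow> g x = 0" "0 < s"
  shows "integrable lborel (\<lambda>x. norm (complex_of_real (xnorm deg x powr a) * g x) powr s)"
proof (rule integrable_compact_support[OF compact_K])
  show "continuous_on K (\<lambda>x. norm (complex_of_real (xnorm deg x powr a) * g x) powr s)"
  proof (rule continuous_on_powr')
    show "continuous_on K (\<lambda>x. norm (complex_of_real (xnorm deg x powr a) * g x))"
      by (rule continuous_on_norm[OF continuous_on_mult[OF continuous_on_of_real
            [OF continuous_on_subset[OF continuous_on_xnorm_powr K_subset]] assms(1)]])
  qed (use assms in auto)
qed (use assms in simp)

text \<open>Apply the divergence identity to \<Phi> = |x'|^(-\<alpha>) |f|^p. The weight contributes
  -\<alpha> \<Phi> to R \<Phi>, which turns the factor N into N - \<alpha>.\<close>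

lemma integral_radial_powr:
  assumes p: "1 < p"
  shows "(\<integral>x. xnorm deg x powr (-\<alpha>) * (p * ((norm (f x) powr (p - 2) *\<^sub>R f x) \<bullet> radial_H gmul deg f x)) \<partial>lborel)
     = - (real (Ndim deg) - \<alpha>) * (\<integral>x. xnorm deg x powr (-\<alpha>) * norm (f x) powr p \<partial>lborel)"
    and "integrable lborel (\<lambda>x. xnorm deg x powr (-\<alpha>) * (p * ((norm (f x) powr (p - 2) *\<^sub>R f x) \<bullet> radial_H gmul deg f x)))"
    and "integrable lborel (\<lambda>x. xnorm deg x powr (-\<alpha>) * norm (f x) powr p)"
proof -
  let ?U = "{x. xnorm deg x \<noteq> 0}"
  let ?W = "\<lambda>x. xnorm deg x powr (-\<alpha>)"
  let ?v = "\<lambda>x. norm (f x) powr (p - 2) *\<^sub>R f x"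
  define \<Phi> where "\<Phi> = (\<lambda>x. ?W x * norm (f x) powr p)"
  define \<Phi>' where "\<Phi>' = (\<lambda>x h. ?W x * (p * (?v x \<bullet> Df x h))
     + (-\<alpha> * xnorm deg x powr (-\<alpha> - 2) * (\<Sum>j\<in>first_stratum deg. x $ j * h $ j)) * norm (f x) powr p)"
  have 0: "\<Phi> x = 0" "\<Phi>' x = (\<lambda>_. 0)" if "x \<notin> K" for x
    using that by (auto simp: \<Phi>_def \<Phi>'_def f_eq_0)
  have der: "(\<Phi> has_derivative \<Phi>' x) (at x)" for x
  proof (cases "x \<in> K")
    case True
    have 1: "((\<lambda>x. norm (f x) powr p) has_derivative (\<lambda>h. p * (?v x \<bullet> Df x h))) (at x)"
      by (rule has_derivative_compose[OF has_derivative_f has_derivative_norm_powr[OF p]])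
    have 2: "(?W has_derivative (\<lambda>h. -\<alpha> * xnorm deg x powr (-\<alpha> - 2) * (\<Sum>j\<in>first_stratum deg. x $ j * h $ j))) (at x)"
      using True K_subset by (intro has_derivative_xnorm_powr) auto
    show ?thesis unfolding \<Phi>_def \<Phi>'_def by (rule has_derivative_mult[OF 2 1])
  next
    case False
    then show ?thesis
      using has_derivative_zero_outside_closed[OF compact_imp_closed[OF compact_K] 0(1) False] by (simp add: 0(2))
  qed
  have npc: "continuous_on S (\<lambda>x. norm (f x) powr p)" for S
    using p by (intro continuous_on_powr' continuous_intros continuous_on_f) auto
  have cont: "continuous_on UNIV (\<lambda>x. \<Phi>' x h)" for h
  proof (rule continuous_on_UNIV_if_compact_support[OF open_xnorm_nonzero compact_K K_subset])
    show "continuous_on ?U (\<lambda>x. \<Phi>' x h)"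
      unfolding \<Phi>'_def
      by (intro continuous_on_add continuous_on_mult continuous_on_inner continuous_on_sum continuous_on_const
          continuous_on_component continuous_on_id continuous_on_xnorm_powr
          continuous_on_norm_f_powr[OF p] continuous_on_Df npc)
  qed (simp add: 0)
  \<comment> \<open>On x' = 0 both sides are 0, since \<open>0 powr _ = 0\<close>.\<close>
  have eq: "\<Phi>' x (radial_field x) = ?W x * (p * (?v x \<bullet> radial_H gmul deg f x)) - \<alpha> * \<Phi> x" for x
  proof (cases "xnorm deg x = 0")
    case False
    then have "xnorm deg x powr (-\<alpha> - 2) * (xnorm deg x)\<^sup>2 = ?W x"
      using xnorm_nonneg[of deg x] by (simp add: powr_diff)
    then show ?thesis
      by (simp add: \<Phi>'_def \<Phi>_def sum_first_stratum_radial_field radial_H_eq)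
  qed (simp add: \<Phi>'_def \<Phi>_def)
  show int\<Phi>: "integrable lborel (\<lambda>x. ?W x * norm (f x) powr p)"
    using integrable_compact_support[OF compact_K has_derivative_continuous_on[OF has_derivative_at_withinI[OF der]] 0(1)]
    by (simp add: \<Phi>_def)
  show int1: "integrable lborel (\<lambda>x. ?W x * (p * (?v x \<bullet> radial_H gmul deg f x)))"
  proof (rule integrable_compact_support[OF compact_K])
    show "continuous_on K (\<lambda>x. ?W x * (p * (?v x \<bullet> radial_H gmul deg f x)))"
      by (intro continuous_on_mult continuous_on_inner continuous_on_const
          continuous_on_subset[OF continuous_on_xnorm_powr K_subset] continuous_on_norm_f_powr[OF p] continuous_on_radial_H)
  qed (simp add: radial_H_eq_0)
  have "(\<integral>x. \<Phi>' x (radial_field x) \<partial>lborel) = - real (Ndim deg) * (\<integral>x. \<Phi> x \<partial>lborel)"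
    by (rule integral_radial_derivative[OF der cont compact_K 0(1)])
  then show "(\<integral>x. ?W x * (p * (?v x \<bullet> radial_H gmul deg f x)) \<partial>lborel)
     = - (real (Ndim deg) - \<alpha>) * (\<integral>x. ?W x * norm (f x) powr p \<partial>lborel)"
    using int\<Phi> int1 by (simp add: eq \<Phi>_def algebra_simps)
qed

text \<open>After \<open>Cp_add_scaled\<close> the integral of |\<xi>|^p cancels. The cross term
  integrates to -p |k|^p times the weighted integral of |f|^p because N - \<alpha> = p k; with the
  coefficient (p-1) |k|^p, the subtracted integral contributes -|k|^p.\<close>

lemma bracket_eq:
  fixes p \<alpha> :: real
  defines "k \<equiv> (real (Ndim deg) - \<alpha>) / p"
  defines "w \<equiv> (\<lambda>x. complex_of_real (xnorm deg x powr (\<alpha> / p)))"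
  assumes p: "1 < p"
  shows "Lp_norm p (\<lambda>x. radial_H gmul deg f x / w x) powr p
      - (\<integral>x. Cp p (radial_H gmul deg f x / w x)
           (radial_H gmul deg f x / w x + complex_of_real k * (f x / w x)) \<partial>lborel)
     = \<bar>k\<bar> powr p * (\<integral>x. norm (complex_of_real (xnorm deg x powr (- \<alpha> / p)) * f x) powr p \<partial>lborel)"
proof -
  let ?W = "\<lambda>x. xnorm deg x powr (-\<alpha>)"
  let ?v = "\<lambda>x. norm (f x) powr (p - 2) *\<^sub>R f x"
  let ?\<xi> = "\<lambda>x. radial_H gmul deg f x / w x"
  let ?A = "\<integral>x. ?W x * norm (f x) powr p \<partial>lborel"
  \<comment> \<open>This also holds where x' = 0: division by 0 and powers of 0 both give 0.\<close>
  have \<xi>eq: "?\<xi> x = complex_of_real (xnorm deg x powr (- \<alpha> / p)) * radial_H gmul deg f x" for x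
    by (simp add: w_def powr_minus field_simps)
  have \<xi>int: "integrable lborel (\<lambda>x. norm (?\<xi> x) powr p)"
    unfolding \<xi>eq using p by (intro integrable_weighted continuous_on_radial_H) (auto simp: radial_H_eq_0)
  have Lp: "Lp_norm p ?\<xi> powr p = (\<integral>x. norm (?\<xi> x) powr p \<partial>lborel)"
    using p by (simp add: Lp_norm_def powr_powr)
  have Aeq: "norm (complex_of_real (xnorm deg x powr (- \<alpha> / p)) * f x) powr p = ?W x * norm (f x) powr p" for x
    using p by (simp add: norm_mult powr_mult powr_powr)
  have pt: "Cp p (?\<xi> x) (?\<xi> x + complex_of_real k * (f x / w x))
     = norm (?\<xi> x) powr p + (p - 1) * \<bar>k\<bar> powr p * (?W x * norm (f x) powr p)
       + k * \<bar>k\<bar> powr (p - 2) * (?W x * (p * (?v x \<bullet> radial_H gmul deg f x)))" for x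
  proof -
    define m where "m = xnorm deg x powr (- \<alpha> / p)"
    have u: "f x / w x = m *\<^sub>R f x" and \<xi>: "?\<xi> x = m *\<^sub>R radial_H gmul deg f x"
      by (auto simp: m_def w_def powr_minus scaleR_conv_of_real field_simps)
    have mp: "m powr p = ?W x" using p by (simp add: m_def powr_powr)
    have m0: "m \<ge> 0" by (simp add: m_def)
    have "norm (f x / w x) powr p = ?W x * norm (f x) powr p"
      using m0 by (simp add: u powr_mult mp)
    moreover have "(norm (f x / w x) powr (p - 2) *\<^sub>R (f x / w x)) \<bullet> ?\<xi> x = ?W x * (?v x \<bullet> radial_H gmul deg f x)"
    proof -
      have "m powr (p - 2) * m * m = m powr p"
        using m0 by (cases "m = 0") (auto simp: powr_diff power2_eq_square)
      then show ?thesis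
        using m0 unfolding u \<xi> by (simp add: powr_mult mp[symmetric] mult_ac)
    qed
    ultimately show ?thesis
      using Cp_add_scaled[OF p, of "?\<xi> x" k "f x / w x"] by (simp add: mult_ac)
  qed
  note I = integral_radial_powr[OF p, of \<alpha>]
  have "(\<integral>x. Cp p (?\<xi> x) (?\<xi> x + complex_of_real k * (f x / w x)) \<partial>lborel)
      = (\<integral>x. norm (?\<xi> x) powr p \<partial>lborel) + (p - 1) * \<bar>k\<bar> powr p * ?A
        + k * \<bar>k\<bar> powr (p - 2) * (- (real (Ndim deg) - \<alpha>) * ?A)"
    unfolding pt by (subst Bochner_Integration.integral_add, (intro Bochner_Integration.integrable_add integrable_mult_right \<xi>int I)+)+
      (simp only: integral_mult_right_zero I(1))
  moreover have Nk: "real (Ndim deg) - \<alpha> = p * k" using p by (simp add: k_def)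
  have kk: "\<bar>k\<bar> powr p = k * \<bar>k\<bar> powr (p - 2) * k"
    by (cases "k = 0") (auto simp: powr_diff power2_eq_square)
  have "(p - 1) * \<bar>k\<bar> powr p * ?A + k * \<bar>k\<bar> powr (p - 2) * (- (real (Ndim deg) - \<alpha>) * ?A)
      = - (\<bar>k\<bar> powr p * ?A)"
    unfolding Nk kk by (simp add: algebra_simps)
  ultimately show ?thesis
    unfolding Lp Aeq by linarith
qed

text \<open>As the bracket is known exactly, the constant factors out of the right-hand side, and
  both claims become statements about weighted norms of f alone.\<close>

lemma gl_rhs_eq:
  assumes p: "1 < p"
  shows "gl_rhs gmul deg p q \<alpha> b \<delta> f = rpow \<bar>(real (Ndim deg) - \<alpha>) / p\<bar> \<delta>
     * (rpow (\<integral>x. norm (complex_of_real (xnorm deg x powr (- \<alpha> / p)) * f x) powr p \<partial>lborel) (\<delta> / p)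
       * rpow (Lp_norm q (\<lambda>x. complex_of_real (xnorm deg x powr (\<alpha> * b / p)) * f x)) (1 - \<delta>))"
  unfolding gl_rhs_def Let_def bracket_eq[OF p]
  using p by (simp add: rpow_mult_powr)

text \<open>The balance condition makes \<delta> r/p and (1-\<delta>) r/q complementary Hoelder
  weights. Equality is immediate in the listed cases: for \<delta> in {0, 1} only one factor
  remains, and for q = p, b = -1 both factors are powers of the same norm.\<close>

lemma gl_interpolation:
  fixes p q r \<delta> \<alpha> b c :: real
  assumes p: "1 < p" and q: "1 < q" and r: "0 < r" and d0: "0 \<le> \<delta>" and d1: "\<delta> \<le> 1"
    and bal: "\<delta> * r / p + (1 - \<delta>) * r / q = 1"
    and cdef: "c = - \<delta> + b * (1 - \<delta>)"
  defines "A \<equiv> (\<integral>x. norm (complex_of_real (xnorm deg x powr (- \<alpha> / p)) * f x) powr p \<partial>lborel)"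
  defines "R \<equiv> rpow A (\<delta> / p) * rpow (Lp_norm q (\<lambda>x. complex_of_real (xnorm deg x powr (\<alpha> * b / p)) * f x)) (1 - \<delta>)"
  shows "gl_lhs_norm deg p r \<alpha> c f \<le> R"
    and "(q = p \<and> b = -1) \<or> \<delta> = 0 \<or> \<delta> = 1 \<Longrightarrow> gl_lhs_norm deg p r \<alpha> c f = R"
proof -
  define B where "B = (\<integral>x. norm (complex_of_real (xnorm deg x powr (\<alpha> * b / p)) * f x) powr q \<partial>lborel)"
  have AB: "A \<ge> 0" "B \<ge> 0" by (auto simp: A_def B_def)
  \<comment> \<open>For \<delta> = 0 the balance forces r = q and c = b, for \<delta> = 1 it forces
    r = p and c = -1; \<open>rpow\<close> with exponent 0 turns the other factor into 1 even if its
    base is 0.\<close>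
  have e0: "gl_lhs_norm deg p r \<alpha> c f = R" if "\<delta> = 0"
    using that bal cdef q by (simp add: gl_lhs_norm_def R_def rpow_def Lp_norm_def)
  have e1: "gl_lhs_norm deg p r \<alpha> c f = R" if "\<delta> = 1"
    using that bal cdef p by (simp add: gl_lhs_norm_def R_def rpow_def Lp_norm_def A_def)
  have e2: "gl_lhs_norm deg p r \<alpha> c f = R" if "q = p" "b = -1"
  proof -
    have "r = p" using bal that p by (simp add: field_simps)
    have "c = -1" using cdef that by simp
    have "rpow A (\<delta> / p) * rpow (A powr (1 / p)) (1 - \<delta>) = A powr (1 / p)"
      using AB p by (auto simp: rpow_def powr_powr diff_divide_distrib simp flip: powr_add)
    then show ?thesis
      using \<open>r = p\<close> \<open>c = -1\<close> that by (simp add: gl_lhs_norm_def R_def Lp_norm_def A_def)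
  qed
  show "(q = p \<and> b = -1) \<or> \<delta> = 0 \<or> \<delta> = 1 \<Longrightarrow> gl_lhs_norm deg p r \<alpha> c f = R"
    using e0 e1 e2 by blast
  show "gl_lhs_norm deg p r \<alpha> c f \<le> R"
  proof (cases "\<delta> = 0 \<or> \<delta> = 1")
    case True
    then show ?thesis using e0 e1 by auto
  next
    case False
    then have d: "0 < \<delta>" "\<delta> < 1" using d0 d1 by auto
    define s where "s = \<delta> * r / p"
    have s1: "1 - s = (1 - \<delta>) * r / q" using bal by (simp add: s_def)
    have "0 < (1 - \<delta>) * r / q" using d q r by simp
    then have "s < 1" using s1 by linarith
    moreover have "0 < s" using d p r by (simp add: s_def)
    ultimately have s: "0 < s" "s < 1" by auto
    have pt: "norm (complex_of_real (xnorm deg x powr (\<alpha> * c / p)) * f x) powr r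
       = (norm (complex_of_real (xnorm deg x powr (- \<alpha> / p)) * f x) powr p) powr s
         * (norm (complex_of_real (xnorm deg x powr (\<alpha> * b / p)) * f x) powr q) powr (1 - s)" for x
    proof (cases "xnorm deg x = 0 \<or> f x = 0")
      case True
      then show ?thesis using r p q by auto
    next
      case False
      let ?m = "xnorm deg x" and ?y = "norm (f x)"
      have ps: "p * s = \<delta> * r" "q * (1 - s) = (1 - \<delta>) * r" using p q by (simp add: s_def, simp add: s1)
      have "(norm (complex_of_real (?m powr (- \<alpha> / p)) * f x) powr p) powr s
          * (norm (complex_of_real (?m powr (\<alpha> * b / p)) * f x) powr q) powr (1 - s)
          = (?m powr (- \<alpha> / p * (\<delta> * r)) * ?y powr (\<delta> * r)) * (?m powr (\<alpha> * b / p * ((1 - \<delta>) * r)) * ?y powr ((1 - \<delta>) * r))"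
        by (simp only: powr_powr mult.assoc ps norm_mult norm_of_real powr_mult abs_ge_zero powr_ge_zero norm_ge_zero abs_of_nonneg)
      also have "\<dots> = ?m powr (- \<alpha> / p * (\<delta> * r) + \<alpha> * b / p * ((1 - \<delta>) * r)) * ?y powr (\<delta> * r + (1 - \<delta>) * r)"
        by (simp only: powr_add mult_ac)
      \<comment> \<open>This is where the relation between c, b and \<delta> enters: it matches the
        exponents of |x'|.\<close>
      also have "- \<alpha> / p * (\<delta> * r) + \<alpha> * b / p * ((1 - \<delta>) * r) = \<alpha> * c / p * r"
        using p by (simp add: cdef field_simps)
      also have "\<delta> * r + (1 - \<delta>) * r = r" by (simp add: algebra_simps)
      finally show ?thesis by (simp add: norm_mult powr_mult powr_powr)
    qed
    have "(\<integral>x. norm (complex_of_real (xnorm deg x powr (\<alpha> * c / p)) * f x) powr r \<partial>lborel) \<le> A powr s * B powr (1 - s)"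
      unfolding pt A_def B_def
      using s p q by (intro integral_Holder_interpolation integrable_weighted continuous_on_f) (auto simp: f_eq_0)
    then have "gl_lhs_norm deg p r \<alpha> c f \<le> (A powr s * B powr (1 - s)) powr (1 / r)"
      unfolding gl_lhs_norm_def Lp_norm_def using r by (intro powr_mono2) auto
    also have "\<dots> = A powr (\<delta> / p) * (B powr (1 / q)) powr (1 - \<delta>)"
    proof -
      have "s * (1 / r) = \<delta> / p" "(1 - s) * (1 / r) = 1 / q * (1 - \<delta>)"
        using r by (simp add: s_def, simp add: s1)
      then show ?thesis by (simp only: powr_mult powr_powr powr_ge_zero)
    qed
    also have "\<dots> = R"
      using d p by (simp add: R_def rpow_def Lp_norm_def B_def)
    finally show ?thesis .
  qed
qed

end

section \<open>Positivity for bump functions and conclusion\<close>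

lemma test_funs_obtain_locale:
  assumes "stratified_group gmul deg" "f \<in> test_funs deg"
  obtains K where "stratified_test_fun gmul deg f K"
  using assms
  by (auto simp: test_funs_def stratified_test_fun_def stratified_test_fun_axioms_def stratified_def)

text \<open>The weight and the bump are both nonzero on a ball, and a vanishing integral would make
  this ball negligible. Positivity lets a larger constant break the inequality strictly.\<close>

lemma gl_lhs_norm_bump_pos:
  fixes deg :: "'n::finite \<Rightarrow> nat"
  assumes G: "stratified_group gmul deg" and j: "j \<in> first_stratum deg" and r: "0 < r"
  shows "gl_lhs_norm deg p r \<alpha> c (\<lambda>x. complex_of_real (flat 0 (1/4 - (x - axis j 1) \<bullet> (x - axis j 1)))) > 0"
    (is "gl_lhs_norm _ _ _ _ _ ?f > 0")
proof -
  obtain K where "stratified_test_fun gmul deg ?f K"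
    by (rule test_funs_obtain_locale[OF G test_fun_bump(1)[OF j]])
  then interpret stratified_test_fun gmul deg ?f K .
  let ?g = "\<lambda>x. norm (complex_of_real (xnorm deg x powr (\<alpha> * c / p)) * ?f x) powr r"
  have int: "integrable lborel ?g"
    using r by (intro integrable_weighted continuous_on_f f_eq_0)
  have "(\<integral>x. ?g x \<partial>lborel) \<noteq> 0"
  proof
    assume "(\<integral>x. ?g x \<partial>lborel) = 0"
    then have "AE x in lborel. ?g x = 0"
      using integral_nonneg_eq_0_iff_AE[OF int] by simp
    moreover have "?g x \<noteq> 0" if "x \<in> ball (axis j 1) (1/2)" for x
    proof -
      have "dist x (axis j 1) < 1/2" using that by (simp add: dist_commute)
      from test_fun_bump(2,3)[OF j this] show ?thesis by simp
    qed
    ultimately have "AE x in lborel. x \<notin> ball (axis j (1::real)) (1/2)"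
      by (auto elim!: eventually_mono)
    then have "ball (axis j (1::real)) (1/2) \<in> null_sets lborel"
      by (subst AE_iff_null_sets) auto
    then have "negligible (ball (axis j (1::real)) (1/2))"
      using negligible_iff_null_sets null_sets_completionI by blast
    then show False
      using open_not_negligible[of "ball (axis j (1::real)) (1/2)"] by simp
  qed
  moreover have "(\<integral>x. ?g x \<partial>lborel) \<ge> 0" by simp
  ultimately show ?thesis
    unfolding gl_lhs_norm_def Lp_norm_def by simp
qed

theorem theorem5p2:
  fixes gmul :: "real^'n \<Rightarrow> real^'n \<Rightarrow> real^'n" and deg :: "'n::finite \<Rightarrow> nat"
    and p q r \<delta> \<alpha> b c :: real
  assumes G: "stratified_group gmul deg"
    and p: "1 < p" and q: "1 < q" and r: "0 < r" and pqr: "r \<le> p + q"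
    and d0: "0 \<le> \<delta>" and d1: "\<delta> \<le> 1" and d2: "(r - q) / r \<le> \<delta>" and d3: "\<delta> \<le> p / r"
    and bal: "\<delta> * r / p + (1 - \<delta>) * r / q = 1"
    and cdef: "c = - \<delta> + b * (1 - \<delta>)"
  shows "(\<forall>f\<in>test_funs deg.
            rpow \<bar>(real (Ndim deg) - \<alpha>) / p\<bar> \<delta> * gl_lhs_norm deg p r \<alpha> c f
              \<le> gl_rhs gmul deg p q \<alpha> b \<delta> f)
       \<and> (\<alpha> \<noteq> real (Ndim deg) \<and> ((q = p \<and> b = -1) \<or> \<delta> = 0 \<or> \<delta> = 1) \<longrightarrow>
            (\<forall>C > rpow \<bar>(real (Ndim deg) - \<alpha>) / p\<bar> \<delta>.
               \<exists>f\<in>test_funs deg. C * gl_lhs_norm deg p r \<alpha> c f > gl_rhs gmul deg p q \<alpha> b \<delta> f))"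
proof (intro conjI ballI impI allI)
  fix f assume "f \<in> test_funs deg"
  then obtain K where "stratified_test_fun gmul deg f K" by (rule test_funs_obtain_locale[OF G])
  then interpret stratified_test_fun gmul deg f K .
  show "rpow \<bar>(real (Ndim deg) - \<alpha>) / p\<bar> \<delta> * gl_lhs_norm deg p r \<alpha> c f \<le> gl_rhs gmul deg p q \<alpha> b \<delta> f"
    unfolding gl_rhs_eq[OF p]
    by (intro mult_left_mono gl_interpolation(1)[OF p q r d0 d1 bal cdef]) (simp add: rpow_def)
next
  fix C
  assume case_hyp: "\<alpha> \<noteq> real (Ndim deg) \<and> ((q = p \<and> b = -1) \<or> \<delta> = 0 \<or> \<delta> = 1)"
    and C: "rpow \<bar>(real (Ndim deg) - \<alpha>) / p\<bar> \<delta> < C"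
  obtain j where j: "j \<in> first_stratum deg"
    using stratified.first_stratum_nonempty[OF stratified.intro[OF G]] by blast
  let ?f = "\<lambda>x. complex_of_real (flat 0 (1/4 - (x - axis j 1) \<bullet> (x - axis j 1)))"
  have f: "?f \<in> test_funs deg" by (rule test_fun_bump(1)[OF j])
  then obtain K where "stratified_test_fun gmul deg ?f K"
    by (rule test_funs_obtain_locale[OF G])
  then interpret stratified_test_fun gmul deg ?f K .
  \<comment> \<open>One bump defeats every larger \<open>C\<close>, since in these cases the
    inequality is an equality for each test function.\<close>
  have "gl_rhs gmul deg p q \<alpha> b \<delta> ?f = rpow \<bar>(real (Ndim deg) - \<alpha>) / p\<bar> \<delta> * gl_lhs_norm deg p r \<alpha> c ?f"
    using gl_rhs_eq[OF p] gl_interpolation(2)[OF p q r d0 d1 bal cdef] case_hyp by simp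
  also have "\<dots> < C * gl_lhs_norm deg p r \<alpha> c ?f"
    by (rule mult_strict_right_mono[OF C gl_lhs_norm_bump_pos[OF G j r]])
  finally show "\<exists>f\<in>test_funs deg. C * gl_lhs_norm deg p r \<alpha> c f > gl_rhs gmul deg p q \<alpha> b \<delta> f"
    using f by blast
qed

end
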